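(* Consider the problem $\min_{x\in C}F(x)$ with $F(x)=f(x)+h(Ax)-g(x)$, with data $\mathcal H,\mathcal K,C,A,f,h,\ell,g,\beta$ satisfying the standing assumptions given in the context. Let $(x_n)_{n\in\mathbb N}$ be a sequence generated by the proximal subgradient algorithm with extrapolation described in the context, with parameters $\overline\lambda,\overline\mu\in\mathbb R_+$, $\delta\in\mathbb R_{++}$ and step sizes $(\tau_n)_{n\in\mathbb N}$, started at $x_{-1}=x_0\in C$. Suppose that $F$ is bounded from below on $C$, that the set $C_0:=\{x\in C:F(x)\le F(x_0)\}$ is bounded, that $g$ is differentiable on an open set containing $C\cap\operatorname{dom}f$ and its gradient $\nabla g$ is Lipschitz continuous with modulus $\ell_g$ on $C\cap\operatorname{dom}f$, and that $\liminf_{n\to+\infty}\tau_n=\overline\tau>0$. Define $G:\mathcal H\times\mathcal H\to(-\infty,+\infty]$ by $$G(x,y):=F(x)+\iota_C(x)+c\|x-y\|^2,\qquad c=\tfrac12(\ell\|A\|^2\overline\lambda+\overline\mu),$$ and suppose that $G$ satisfies the Kurdyka–Łojasiewicz (KL) property at $(\overline x,\overline x)$ for every $\overline x\in C\cap\operatorname{dom}f$. Then: (i) The sequence $(x_n)_{n\in\mathbb N}$ converges to a stationary point $x^*$ of the problem and $\sum_{n=0}^{+\infty}\|x_{n+1}-x_n\|<+\infty$. (ii) Suppose further that $G$ satisfies the KL property with exponent $\theta\in[0,1)$ at $(\overline x,\overline x)$ for every $\overline x\in C\cap\operatorname{dom}f$. Then the following hold: (a) If $\theta=0$, then $(x_n)_{n\in\mathbb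 N}$ converges to $x^*$ in a finite number of steps. (b) If $\theta\in(0,\frac12]$, then there exist $\gamma\in\mathbb R_{++}$ and $\rho\in(0,1)$ such that, for all $n\in\mathbb N$, $\|x_n-x^*\|\le\gamma\rho^{\frac n2}$ and $|F(x_n)-F(x^* )|\le\gamma\rho^n$. (c) If $\theta\in(\frac12,1)$, then there exists $\gamma\in\mathbb R_{++}$ such that, for all $n\in\mathbb N$ with $n\ge1$, $\|x_n-x^*\|\le\gamma n^{-\frac{1-\theta}{2\theta-1}}$ and $|F(x_n)-F(x^* )|\le\gamma n^{-\frac{2-2\theta}{2\theta-1}}$.
   Context: Notation: $\mathbb N=\{0,1,2,\dots\}$, $\mathbb R_+=[0,+\infty)$, $\mathbb R_{++}=(0,+\infty)$. For $\phi:\mathcal H\to[-\infty,+\infty]$, $\operatorname{dom}\phi=\{x:\phi(x)<+\infty\}$; $\phi$ is proper if $\operatorname{dom}\phi\ne\varnothing$ and $\phi$ never takes the value $-\infty$. $\iota_C$ is the indicator function of $C$ ($0$ on $C$, $+\infty$ off $C$). $A^*$ is the adjoint of $A$ and $\|A\|$ its operator norm. $\operatorname{dist}(0,S)=\inf_{s\in S}\|s\|$ (equal to $+\infty$ if $S=\varnothing$). Weak convexity: $\phi$ is weakly convex if $\phi+\frac{\alpha}{2}\|\cdot\|^2$ is convex for some $\alpha\in\mathbb R_+$; its modulus is the smallest such $\alpha$. $\phi$ is weakly convex on a set $O$ with modulus $\alpha$ if $\phi+\iota_O$ is weakly convex with modulus $\alpha$. Standing assumptions: $\mathcal H,\mathcal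 K$ are finite-dimensional real Hilbert spaces; $C\subseteq\mathcal H$ is nonempty and closed; $A:\mathcal H\to\mathcal K$ is linear; $f:\mathcal H\to(-\infty,+\infty]$ is proper and lower semicontinuous (possibly nonsmooth and nonconvex); $h:\mathcal K\to\mathbb R$ is differentiable (possibly nonconvex) with gradient Lipschitz continuous with modulus $\ell$; $g:\mathcal H\to(-\infty,+\infty]$ is (finite-valued,) continuous and weakly convex with modulus $\beta$ on an open convex set containing $C$. The objective is $F(x)=f(x)+h(Ax)-g(x)$; the function $F+\iota_C$ is understood to be $+\infty$ off $C$. Subdifferentials: for an extended-real-valued function $\phi$ on a finite-dimensional real Hilbert space and $x$ with $|\phi(x)|<+\infty$, the Fréchet subdifferential is $$\widehat\partial\phi(x)=\Bigl\{x^*:\ \liminf_{y\to x}\frac{\phi(y)-\phi(x)-\langle x^*,y-x\rangle}{\|y-x\|}\ge0\Bigr\},$$ and the limiting subdifferential $\partial_L\phi(x)$ is the set of $x^*$ for which there exist $x_n\to x$ with $\phi(x_n)\to\phi(x)$ and $x_n^*\in\widehat\partial\phi(x_n)$ with $x_n^*\to x^*$. Both are empty if $|\phi(x)|=+\infty$. $\operatorname{dom}\partial_L\phi=\{x:\partial_L\phi(x)\neq\varnothing\}$. Stationarity: a point $\overline x\in C$ is a stationary point of the problem if $0\in\partial_L(f+\iota_C+h\circ A-g)(\overline x)$. KL property: a proper lower semicontinuous function $G$ on a finite-dimensional real Hilbert space, with values in $(-\infty,+\infty]$, satisfies the KL property at $\overline z\in\operatorname{dom}\partial_LG$ if there are $\eta\in(0,+\infty]$,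 a neighborhood $V$ of $\overline z$, and a continuous concave function $\phi:[0,\eta)\to\mathbb R_+$ such that $\phi$ is continuously differentiable with $\phi'>0$ on $(0,\eta)$, $\phi(0)=0$, and, for all $z\in V$ with $G(\overline z)<G(z)<G(\overline z)+\eta$, $$\phi'(G(z)-G(\overline z))\,\operatorname{dist}(0,\partial_LG(z))\ge1.$$ If $\phi$ can be chosen as $\phi(t)=c_0t^{1-\theta}$ for some $c_0\in\mathbb R_{++}$ and $\theta\in[0,1)$, then $G$ satisfies the KL property at $\overline z$ with exponent $\theta$. Algorithm (proximal subgradient algorithm with extrapolation): let $x_{-1}=x_0\in C$, $\overline\lambda\in\mathbb R_+$, $\overline\mu\in\mathbb R_+$, $\delta\in\mathbb R_{++}$. For each $n=0,1,2,\dots$, choose $$\tau_n\in\Bigl(0,\ \frac{1}{\beta+2\delta+\ell\|A\|^2(2\overline\lambda+1)+2\overline\mu}\Bigr],\quad \lambda_n\in[0,\overline\lambda],\quad \mu_n\in[0,\overline\mu\tau_n],\quad g_n\in\partial_Lg(x_n),$$ set $u_n=x_n+\lambda_n(x_n-x_{n-1})$ and $v_n=x_n+\mu_n(x_n-x_{n-1})$, and take $$x_{n+1}\in\operatorname*{argmin}_{x\in C}\Bigl(f(x)+\tfrac1{2\tau_n}\|x-v_n+\tau_nA^*\nabla h(Au_n)-\tau_ng_n\|^2\Bigr).$$ The sequence $(x_n)_{n\in\mathbb N}$ is infinite (no termination criterion is applied). By the usual convention, the argmin of a function that is identically $+\infty$ on $C$ is empty, so minimizers have finite objective value.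
   Formalization: In (ii)(b) the bound on |F(x_n)-F(x* )| at n=0 is claimed only when F(x_0)<+∞; since x_0 is only required to lie in C, F(x_0)=+∞ is possible and the bound then fails at n=0 (e.g. C=[0,1], f the indicator of {0}, h=g=0, x_0=1). *)

theory Defs
  imports "HOL-Analysis.Analysis"
begin

text \<open>Extended-real-valued functions take values in \<^typ>\<open>ereal\<close>, where
  \<open>\<infinity> + (- \<infinity>) = (- \<infinity>) + \<infinity> = \<infinity>\<close>.  Hence adding \<open>indicat_inf C\<close> to any function yields
  \<open>\<infinity>\<close> off \<open>C\<close>, whatever the values of the function there.\<close>

definition edom :: "('a \<Rightarrow> ereal) \<Rightarrow> 'a set" where
  "edom \<phi> = {x. \<phi> x < \<infinity>}"

definition eproper :: "('a \<Rightarrow> ereal) \<Rightarrow> bool" where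
  "eproper \<phi> \<longleftrightarrow> edom \<phi> \<noteq> {} \<and> (\<forall>x. \<phi> x \<noteq> -\<infinity>)"

definition indicat_inf :: "'a set \<Rightarrow> 'a \<Rightarrow> ereal" where
  "indicat_inf C x = (if x \<in> C then 0 else \<infinity>)"

definition lsc :: "('a::topological_space \<Rightarrow> ereal) \<Rightarrow> bool" where
  "lsc \<phi> \<longleftrightarrow> (\<forall>x. \<phi> x \<le> Liminf (at x) \<phi>)"

definition econvex :: "('a::real_vector \<Rightarrow> ereal) \<Rightarrow> bool" where
  "econvex \<phi> \<longleftrightarrow> convex {(x, r::real). \<phi> x \<le> ereal r}"

text \<open>The modulus is by definition the smallest admissible constant.\<close>

definition weakly_convex_modulus :: "('a::real_inner \<Rightarrow> ereal) \<Rightarrow> real \<Rightarrow> bool" where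
  "weakly_convex_modulus \<phi> \<alpha> \<longleftrightarrow>
     is_arg_min (\<lambda>a. a) (\<lambda>a. 0 \<le> a \<and> econvex (\<lambda>x. \<phi> x + ereal (a / 2 * (norm x)\<^sup>2))) \<alpha>"

definition weakly_convex_modulus_on :: "'a::real_inner set \<Rightarrow> ('a \<Rightarrow> ereal) \<Rightarrow> real \<Rightarrow> bool" where
  "weakly_convex_modulus_on D \<phi> \<alpha> \<longleftrightarrow> weakly_convex_modulus (\<lambda>x. \<phi> x + indicat_inf D x) \<alpha>"

definition frechet_subdiff :: "('a::real_inner \<Rightarrow> ereal) \<Rightarrow> 'a \<Rightarrow> 'a set" where
  "frechet_subdiff \<phi> x =
     {s. \<bar>\<phi> x\<bar> < \<infinity> \<and>
         0 \<le> Liminf (at x) (\<lambda>y. (\<phi> y - \<phi> x - ereal (s \<bullet> (y - x))) / ereal (norm (y - x)))}"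

definition limiting_subdiff :: "('a::real_inner \<Rightarrow> ereal) \<Rightarrow> 'a \<Rightarrow> 'a set" where
  "limiting_subdiff \<phi> x =
     {s. \<bar>\<phi> x\<bar> < \<infinity> \<and>
         (\<exists>X S. X \<longlonglongrightarrow> x \<and> (\<lambda>n. \<phi> (X n)) \<longlonglongrightarrow> \<phi> x \<and>
                (\<forall>n. S n \<in> frechet_subdiff \<phi> (X n)) \<and> S \<longlonglongrightarrow> s)}"

text \<open>Distance from the origin to a set; the infimum over the empty set is \<open>\<infinity>\<close>.\<close>

definition dist0 :: "'a::real_normed_vector set \<Rightarrow> ereal" where
  "dist0 S = (INF s\<in>S. ereal (norm s))"

text \<open>\<open>KL_with G z \<phi>\<close>: the KL inequality holds near \<open>z\<close> with \<open>\<phi>\<close>, restricted to some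
  \<open>[0, \<eta>)\<close> with \<open>0 < \<eta> \<le> \<infinity>\<close>, as desingularizing function.  The notion is only meant for points
  of the domain of the limiting subdifferential, which is made part of the predicate.\<close>

definition KL_with :: "('a::real_inner \<Rightarrow> ereal) \<Rightarrow> 'a \<Rightarrow> (real \<Rightarrow> real) \<Rightarrow> bool" where
  "KL_with G z \<phi> \<longleftrightarrow>
     limiting_subdiff G z \<noteq> {} \<and>
     (\<exists>(\<eta>::ereal) V \<phi>'.
        0 < \<eta> \<and> open V \<and> z \<in> V \<and>
        continuous_on {t. 0 \<le> t \<and> ereal t < \<eta>} \<phi> \<and>
        concave_on {t. 0 \<le> t \<and> ereal t < \<eta>} \<phi> \<and>
        (\<forall>t. 0 \<le> t \<and> ereal t < \<eta> \<longrightarrow> 0 \<le> \<phi> t) \<and>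
        \<phi> 0 = 0 \<and>
        (\<forall>t. 0 < t \<and> ereal t < \<eta> \<longrightarrow> (\<phi> has_real_derivative \<phi>' t) (at t) \<and> 0 < \<phi>' t) \<and>
        continuous_on {t. 0 < t \<and> ereal t < \<eta>} \<phi>' \<and>
        (\<forall>w\<in>V. G z < G w \<and> G w < G z + \<eta> \<longrightarrow>
           1 \<le> ereal (\<phi>' (real_of_ereal (G w - G z))) * dist0 (limiting_subdiff G w)))"

definition KL_property :: "('a::real_inner \<Rightarrow> ereal) \<Rightarrow> 'a \<Rightarrow> bool" where
  "KL_property G z \<longleftrightarrow> (\<exists>\<phi>. KL_with G z \<phi>)"

definition KL_property_exponent :: "('a::real_inner \<Rightarrow> ereal) \<Rightarrow> 'a \<Rightarrow> real \<Rightarrow> bool" where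
  "KL_property_exponent G z \<theta> \<longleftrightarrow>
     0 \<le> \<theta> \<and> \<theta> < 1 \<and> (\<exists>c0>0. KL_with G z (\<lambda>t. c0 * t powr (1 - \<theta>)))"

definition objective ::
    "('a \<Rightarrow> ereal) \<Rightarrow> ('b \<Rightarrow> real) \<Rightarrow> ('a \<Rightarrow> 'b) \<Rightarrow> ('a \<Rightarrow> ereal) \<Rightarrow> 'a \<Rightarrow> ereal" where
  "objective f h A g x = f x + ereal (h (A x)) - g x"

definition stationary_point ::
    "'a::real_inner set \<Rightarrow> ('a \<Rightarrow> ereal) \<Rightarrow> ('b \<Rightarrow> real) \<Rightarrow> ('a \<Rightarrow> 'b) \<Rightarrow> ('a \<Rightarrow> ereal) \<Rightarrow> 'a \<Rightarrow> bool"
  where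
  "stationary_point C f h A g z \<longleftrightarrow>
     z \<in> C \<and> 0 \<in> limiting_subdiff (\<lambda>x. f x + indicat_inf C x + ereal (h (A x)) - g x) z"

text \<open>Minimizers over \<open>C\<close>; empty if the function is identically \<open>\<infinity>\<close> on \<open>C\<close>.\<close>

definition argmin_on :: "'a set \<Rightarrow> ('a \<Rightarrow> ereal) \<Rightarrow> 'a set" where
  "argmin_on C \<phi> = {x \<in> C. \<phi> x < \<infinity> \<and> (\<forall>y\<in>C. \<phi> x \<le> \<phi> y)}"

text \<open>The iterate preceding \<open>x 0\<close> equals \<open>x 0\<close>, which agrees with \<open>x (n - 1)\<close> at \<open>n = 0\<close> because
  subtraction on \<^typ>\<open>nat\<close> truncates.\<close>

definition prox_subgrad_extrap ::
    "'a::euclidean_space set \<Rightarrow> ('a \<Rightarrow> 'b::euclidean_space) \<Rightarrow> ('a \<Rightarrow> ereal) \<Rightarrow> ('b \<Rightarrow> 'b) \<Rightarrow> real \<Rightarrow>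
     ('a \<Rightarrow> ereal) \<Rightarrow> real \<Rightarrow> real \<Rightarrow> real \<Rightarrow> real \<Rightarrow>
     (nat \<Rightarrow> real) \<Rightarrow> (nat \<Rightarrow> real) \<Rightarrow> (nat \<Rightarrow> real) \<Rightarrow> (nat \<Rightarrow> 'a) \<Rightarrow> (nat \<Rightarrow> 'a) \<Rightarrow> bool" where
  "prox_subgrad_extrap C A f grad_h l g \<beta> lam_bar mu_bar \<delta> \<tau> lam \<mu> gs x \<longleftrightarrow>
     x 0 \<in> C \<and>
     (\<forall>n.
        0 < \<tau> n \<and>
        \<tau> n \<le> 1 / (\<beta> + 2 * \<delta> + l * (onorm A)\<^sup>2 * (2 * lam_bar + 1) + 2 * mu_bar) \<and>
        0 \<le> lam n \<and> lam n \<le> lam_bar \<and>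
        0 \<le> \<mu> n \<and> \<mu> n \<le> mu_bar * \<tau> n \<and>
        gs n \<in> limiting_subdiff g (x n) \<and>
        (let u = x n + lam n *\<^sub>R (x n - x (n - 1));
             v = x n + \<mu> n *\<^sub>R (x n - x (n - 1))
         in x (Suc n) \<in> argmin_on C (\<lambda>y. f y + ereal (1 / (2 * \<tau> n) *
              (norm (y - v + \<tau> n *\<^sub>R adjoint A (grad_h (A u)) - \<tau> n *\<^sub>R gs n))\<^sup>2))))"

end

theory Submission
  imports Defs
begin

text \<open>The energy \<open>H n = F (x (n + 1)) + c * (norm (x (n + 1) - x n))\<^sup>2\<close> drops by at least
  \<open>\<delta> * (norm (x (n + 1) - x n))\<^sup>2\<close> in each step: compare \<open>x (n + 1)\<close> with \<open>x n\<close> in the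
  proximal subproblem, and use the descent lemma for \<open>h\<close> and weak convexity of \<open>g\<close>.  Optimality of
  \<open>x (n + 1)\<close> provides a Frechet subgradient of \<open>G\<close> at \<open>(x (n + 1), x n)\<close> of norm at most
  \<open>K\<close> times the sum of the last two step lengths.  Let \<open>d n\<close> be the step lengths and \<open>E n\<close> the
  excess of the energy over its limit, which is \<open>F\<close> at a cluster point.  Concavity of the
  desingularizing function \<open>\<phi>\<close> turns the KL inequality into
  \<open>d (n + 2) \<le> (d (n + 1) + d n) / 4 + K / \<delta> * (\<phi> (E (n + 2)) - \<phi> (E (n + 3)))\<close>, which telescopes;
  so the path has finite length.  For \<open>\<phi> t = c0 * t powr (1 - \<theta>)\<close> the same two estimates give
  \<open>E (n + 2) powr (2 * \<theta>) \<le> L * (E n - E (n + 2))\<close>, whence the rates.\<close>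

section \<open>Real sequences\<close>

text \<open>Extrapolation destroys the monotonicity of \<open>F\<close> along the iterates: it costs
  products of consecutive steps. The quadratic term of the energy pays in advance for the half that
  falls on the previous step, which is the origin of \<open>c\<close>. The same memory makes the
  subgradient at an iterate depend on two steps, so every recursion links the indices
  \<open>n\<close> and \<open>n + 2\<close>. The weight 1/4 matters: the two earlier steps then have
  total weight 1/2, less than 1, and can be absorbed when the inequality is summed. Two weak
  assumptions need care. Since \<open>f\<close> is only lower semicontinuous, its values might jump
  at a cluster point; taking that point as competitor in the proximal subproblem excludes this.
  Since \<open>F (x 0)\<close> may be infinite, the energy estimates concern the iterates from
  \<open>x 1\<close> on, and the bound on \<open>F\<close> at \<open>n = 0\<close> in the linear
  rate carries a guard.\<close>

lemma concave_on_below_tangent: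
  fixes \<phi> :: "real \<Rightarrow> real" and \<eta> :: ereal
  assumes conc: "concave_on {t. 0 \<le> t \<and> ereal t < \<eta>} \<phi>"
    and der: "(\<phi> has_real_derivative D) (at t)"
    and t: "0 < t" "ereal t < \<eta>" and s: "0 \<le> s" "ereal s < \<eta>"
  shows "\<phi> s \<le> \<phi> t + D * (s - t)"
proof -
  let ?S = "{t. 0 \<le> t \<and> ereal t < \<eta>}"
  have conv: "convex_on ?S (\<lambda>t. - \<phi> t)"
    using conc by (simp add: concave_on_def)
  have "is_interval ?S"
    unfolding is_interval_1 by (auto intro: le_less_trans[of "ereal _" "ereal _" \<eta>])
  then have conn: "connected ?S"
    by (simp add: is_interval_connected)
  have eq: "{t. 0 < t \<and> ereal t < \<eta>} = {0<..} \<inter> ereal -` {..<\<eta>}"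
    by auto
  \<comment> \<open>Only the tangent point has to be interior; \<open>s\<close> may be the endpoint
    0, where \<open>\<phi>\<close> need not be differentiable.\<close>
  have "open {t. 0 < t \<and> ereal t < \<eta>}"
    unfolding eq by (intro open_Int open_vimage open_lessThan open_greaterThan continuous_intros)
  then have int: "t \<in> interior ?S"
    using t by (intro interiorI[of "{t. 0 < t \<and> ereal t < \<eta>}"]) auto
  have "((\<lambda>t. - \<phi> t) has_real_derivative - D) (at t within ?S)"
    using der by (auto intro!: derivative_eq_intros intro: has_field_derivative_at_within)
  from convex_on_imp_above_tangent[OF conv conn int _ this, of s] s
  show ?thesis by simp
qed

text \<open>Each step enters the next two inequalities with weight 1/4. Half of it is booked in the
  sum and the rest is kept as a debt: half the partial sum plus
  \<open>(2 * d (m + 1) + d m) / 4 + p m\<close> never increases with \<open>m\<close>.\<close>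

lemma sum_le_of_potential:
  fixes d p :: "nat \<Rightarrow> real"
  assumes "N \<le> m" and nn: "\<And>n. 0 \<le> d n"
    and step: "\<And>n. N \<le> n \<Longrightarrow> n < m \<Longrightarrow> d (n + 2) \<le> (d (n + 1) + d n) / 4 + (p n - p (Suc n))"
    and p: "0 \<le> p m"
  shows "(\<Sum>n=N..<m. d (n + 2)) \<le> d (N + 1) + d N / 2 + 2 * p N"
proof -
  have "(\<Sum>n=N..<m. d (n + 2)) / 2 + (2 * d (m + 1) + d m) / 4 + p m
      \<le> (2 * d (N + 1) + d N) / 4 + p N"
    using \<open>N \<le> m\<close> step
  proof (induction m rule: dec_induct)
    case (step k)
    have "d (k + 2) \<le> (d (k + 1) + d k) / 4 + (p k - p (Suc k))"
      using step.prems step.hyps by simp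
    moreover have "(\<Sum>n=N..<k. d (n + 2)) / 2 + (2 * d (k + 1) + d k) / 4 + p k
        \<le> (2 * d (N + 1) + d N) / 4 + p N"
      using step by simp
    moreover have "(\<Sum>n=N..<Suc k. d (n + 2)) = (\<Sum>n=N..<k. d (n + 2)) + d (k + 2)"
      using step.hyps by (simp add: sum.atLeastLessThan_Suc)
    ultimately show ?case by (simp add: field_simps)
  qed simp
  with p nn[of m] nn[of "m+1"] show ?thesis by (simp add: field_simps)
qed

text \<open>Solving for \<open>E (n + 2)\<close> gives a contraction by
  \<open>q = M / (1 + M)\<close> over two indices, hence the factor \<open>sqrt q\<close> per
  index.\<close>

lemma geometric_decay:
  fixes E :: "nat \<Rightarrow> real"
  assumes nn: "\<And>n. 0 \<le> E n" and rec: "\<forall>\<^sub>F n in sequentially. E (n + 2) \<le> M * (E n - E (n + 2))"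
    and "0 < M"
  shows "\<exists>C \<rho>. 0 < C \<and> 0 < \<rho> \<and> \<rho> < 1 \<and> (\<forall>\<^sub>F n in sequentially. E n \<le> C * \<rho> ^ n)"
proof -
  define q \<rho> where "q = M / (1 + M)" and "\<rho> = sqrt q"
  have q: "0 < q" "q < 1" using \<open>0 < M\<close> by (auto simp: q_def)
  have \<rho>: "0 < \<rho>" "\<rho> < 1" "\<rho>\<^sup>2 = q" using q by (auto simp: \<rho>_def)
  obtain N where N: "\<And>n. n \<ge> N \<Longrightarrow> E (n + 2) \<le> M * (E n - E (n + 2))"
    using rec by (auto simp: eventually_sequentially)
  have step: "E (n + 2) \<le> q * E n" if "n \<ge> N" for n
    using N[OF that] \<open>0 < M\<close> by (simp add: q_def field_simps)
  \<comment> \<open>Even and odd indices form separate chains, hence two starting values; the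
    summand 1 keeps \<open>C\<close> positive if both vanish.\<close>
  define C where "C = E N / \<rho> ^ N + E (N + 1) / \<rho> ^ (N + 1) + 1"
  have C: "0 < C" using nn \<rho> by (auto simp: C_def intro!: add_nonneg_pos add_nonneg_nonneg)
  have "E N = (E N / \<rho> ^ N) * \<rho> ^ N" using \<rho> by simp
  also have "\<dots> \<le> C * \<rho> ^ N" using nn \<rho> by (intro mult_right_mono) (auto simp: C_def)
  finally have base: "E N \<le> C * \<rho> ^ N" .
  have "E (N + 1) = (E (N + 1) / \<rho> ^ (N + 1)) * \<rho> ^ (N + 1)" using \<rho> by simp
  also have "\<dots> \<le> C * \<rho> ^ (N + 1)"
    using nn \<rho> by (intro mult_right_mono) (auto simp: C_def intro!: add_nonneg_nonneg)
  finally have base': "E (N + 1) \<le> C * \<rho> ^ (N + 1)" .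
  have "E n \<le> C * \<rho> ^ n \<and> E (n + 1) \<le> C * \<rho> ^ (n + 1)" if "n \<ge> N" for n
    using that
  proof (induction n rule: dec_induct)
    case (step n)
    have "E (n + 2) \<le> q * E n" using \<open>\<And>n. n \<ge> N \<Longrightarrow> E (n + 2) \<le> q * E n\<close> step by simp
    also have "\<dots> \<le> q * (C * \<rho> ^ n)" using step q by (intro mult_left_mono) auto
    also have "\<dots> = C * \<rho> ^ (n + 2)" by (simp add: power_add power2_eq_square flip: \<rho>(3))
    finally show ?case using step by (simp add: eval_nat_numeral)
  qed (use base base' in auto)
  then have "\<forall>\<^sub>F n in sequentially. E n \<le> C * \<rho> ^ n" by (auto simp: eventually_sequentially)
  with C \<rho> show ?thesis by blast
qed

text \<open>Mean value theorem: the derivative of \<open>t powr (- s)\<close> is largest in modulus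
  at the left end of the interval.\<close>

lemma powr_minus_diff_le:
  fixes s a b :: real
  assumes "0 < s" "0 < a" "a \<le> b"
  shows "a powr (- s) - b powr (- s) \<le> s * a powr (- s - 1) * (b - a)"
proof (cases "a = b")
  case False
  then have "a < b" using assms by simp
  obtain z where z: "a < z" "z < b"
    "b powr (- s) - a powr (- s) = (b - a) * (- s * z powr (- s - 1))"
  proof -
    have "\<exists>z>a. z < b \<and> b powr (- s) - a powr (- s) = (b - a) * (- s * z powr (- s - 1))"
      using \<open>a < b\<close> assms by (intro MVT2) (auto intro!: derivative_eq_intros)
    then show ?thesis using that by blast
  qed
  have "z powr (- s - 1) \<le> a powr (- s - 1)"
    using z assms by (intro powr_mono2') auto
  then have "s * (b - a) * z powr (- s - 1) \<le> s * (b - a) * a powr (- s - 1)"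
    using assms by (intro mult_left_mono) auto
  with z show ?thesis by (simp add: algebra_simps)
qed simp

text \<open>Rests on \<open>n + 3 \<le> 4 * n\<close>. The rates are first obtained for
  \<open>x (n + 3)\<close>, and this moves them back to \<open>x n\<close>.\<close>

lemma powr_shift3:
  assumes "0 \<le> a" "1 \<le> n"
  shows "real n powr (- a) \<le> 4 powr a * real (n + 3) powr (- a)"
proof -
  have "real n powr (- a) \<le> (real (n + 3) / 4) powr (- a)"
    using assms by (intro powr_mono2') auto
  also have "\<dots> = 4 powr a * real (n + 3) powr (- a)"
    by (subst powr_divide) (auto simp: powr_minus divide_simps)
  finally show ?thesis .
qed

lemma eventually_shift3:
  assumes "\<forall>\<^sub>F n in sequentially. P (n + 3)"
  shows "eventually P sequentially"
  using assms by (rule eventually_sequentially_seg[THEN iffD1])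

text \<open>Since \<open>t + t powr p / M\<close> increases with \<open>t\<close>, a bound \<open>C * n powr -s\<close> is inherited by the
  next term as soon as it is a supersolution of the recursion; with \<open>s = 1 / (p - 1)\<close> both sides
  scale like \<open>n powr (- s - 1)\<close>, so this only requires \<open>C\<close> to be large.\<close>

lemma polynomial_decay:
  fixes E :: "nat \<Rightarrow> real"
  assumes nn: "\<And>n. 0 \<le> E n"
    and rec: "\<forall>\<^sub>F n in sequentially. E (n + 2) powr p \<le> M * (E n - E (n + 2))"
    and "0 < M" "1 < p"
  shows "\<exists>C>0. \<forall>\<^sub>F n in sequentially. E n \<le> C * real n powr (- (1 / (p - 1)))"
proof -
  define s where "s = 1 / (p - 1)"
  have s: "0 < s" "s * p = s + 1" using \<open>1 < p\<close> by (auto simp: s_def field_simps)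
  obtain N0 where N0: "\<And>n. n \<ge> N0 \<Longrightarrow> E (n + 2) powr p \<le> M * (E n - E (n + 2))"
    using rec by (auto simp: eventually_sequentially)
  define N where "N = max N0 1"
  have N: "N \<ge> 1" "\<And>n. n \<ge> N \<Longrightarrow> E (n + 2) powr p \<le> M * (E n - E (n + 2))"
    using N0 by (auto simp: N_def)
  \<comment> \<open>\<open>B\<close> collects the losses of the comparison below: 2 is the index
    gap, and \<open>3 powr (s + 1)\<close> comes from \<open>n \<ge> (n + 2) / 3\<close>.\<close>
  define B where "B = 2 * s * 3 powr (s + 1) * M"
  have B: "0 < B" using s \<open>0 < M\<close> by (simp add: B_def)
  \<comment> \<open>The first entry makes \<open>C powr p\<close> dominate \<open>B * C\<close>; the
    other two start the induction on both parities.\<close>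
  define C where "C = max (B powr s) (max (E N * N powr s) (E (N + 1) * (N + 1) powr s))"
  have C: "0 < C" "B powr s \<le> C" "E N * N powr s \<le> C" "E (N + 1) * (N + 1) powr s \<le> C"
    using B by (auto simp: C_def less_max_iff_disj)
  have CB: "B * C \<le> C powr p"
  proof -
    have "B = (B powr s) powr (p - 1)"
      using \<open>1 < p\<close> B by (simp add: powr_powr s_def)
    also have "\<dots> \<le> C powr (p - 1)" using C \<open>1 < p\<close> by (intro powr_mono2) auto
    finally have "B * C \<le> C powr (p - 1) * C powr 1"
      using C by (intro mult_mono) auto
    then show ?thesis by (simp only: powr_add[symmetric]) simp
  qed
  have base: "E N \<le> C * real N powr (- s)" "E (N + 1) \<le> C * real (N + 1) powr (- s)"
    using C N by (auto simp: powr_minus field_simps)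
  have step: "E (n + 2) \<le> C * real (n + 2) powr (- s)"
    if n: "n \<ge> N" and IH: "E n \<le> C * real n powr (- s)" for n
  \<comment> \<open>If the bound failed at \<open>n + 2\<close>, then
    \<open>E (n + 2) powr p\<close> would be too large, and the drop \<open>E n - E (n + 2)\<close>
    too small, for the recursion.\<close>
  proof (rule ccontr)
    assume "\<not> ?thesis"
    then have gt: "C * real (n + 2) powr (- s) < E (n + 2)" by simp
    have n1: "n \<ge> 1" using n N by simp
    have "(C * real (n + 2) powr (- s)) powr p \<le> E (n + 2) powr p"
      using gt C \<open>1 < p\<close> by (intro powr_mono2) auto
    also have "\<dots> \<le> M * (E n - E (n + 2))" using N n by blast
    also have "\<dots> < M * (C * real n powr (- s) - C * real (n + 2) powr (- s))"
      using gt IH \<open>0 < M\<close> by (intro mult_strict_left_mono) auto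
    also have "\<dots> = M * C * (real n powr (- s) - real (n + 2) powr (- s))"
      by (simp add: algebra_simps)
    also have "\<dots> \<le> M * C * (s * real n powr (- s - 1) * (real (n + 2) - real n))"
      using n1 \<open>0 < M\<close> C s by (intro mult_left_mono powr_minus_diff_le) auto
    also have "\<dots> = 2 * s * M * C * real n powr (- s - 1)" by simp
    also have "\<dots> \<le> 2 * s * M * C * (real (n + 2) / 3) powr (- s - 1)"
      using n1 s \<open>0 < M\<close> C by (intro mult_left_mono powr_mono2') auto
    also have "(real (n + 2) / 3) powr (- s - 1) = 3 powr (s + 1) * real (n + 2) powr (- s - 1)"
      by (subst powr_divide) (auto simp: powr_minus field_simps simp flip: powr_add)
    also have "2 * s * M * C * (3 powr (s + 1) * real (n + 2) powr (- s - 1))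
        = B * C * real (n + 2) powr (- s - 1)"
      by (simp add: B_def)
    also have "\<dots> \<le> C powr p * real (n + 2) powr (- s - 1)"
      using CB by (intro mult_right_mono) auto
    also have "\<dots> = (C * real (n + 2) powr (- s)) powr p"
    proof -
      have "- s * p = - s - 1" using s by simp
      then show ?thesis using C by (simp add: powr_mult powr_powr)
    qed
    finally show False by simp
  qed
  have "E n \<le> C * real n powr (- s) \<and> E (n + 1) \<le> C * real (n + 1) powr (- s)" if "n \<ge> N" for n
    using that
  proof (induction n rule: dec_induct)
    case (step n)
    then show ?case
      using \<open>\<And>n. n \<ge> N \<Longrightarrow> E n \<le> C * real n powr (- s) \<Longrightarrow> E (n + 2) \<le> C * real (n + 2) powr (- s)\<close>[of n]
      by simp
  qed (use base in auto)
  then have "\<forall>\<^sub>F n in sequentially. E n \<le> C * real n powr (- s)"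
    by (auto simp: eventually_sequentially)
  with C show ?thesis by (auto simp: s_def)
qed

lemma eventually_le_imp_le_from:
  fixes a b :: "nat \<Rightarrow> real"
  assumes "\<forall>\<^sub>F n in sequentially. a n \<le> B * b n" "\<And>n. n \<ge> k \<Longrightarrow> 0 < b n"
  shows "\<exists>\<gamma>>0. \<forall>\<gamma>'\<ge>\<gamma>. \<forall>n\<ge>k. a n \<le> \<gamma>' * b n"
proof -
  obtain N where N: "\<And>n. n \<ge> N \<Longrightarrow> a n \<le> B * b n"
    using assms(1) by (auto simp: eventually_sequentially)
  define S where "S = (\<Sum>n=k..<N. \<bar>a n\<bar> / b n)"
  have S: "0 \<le> S" unfolding S_def using assms(2) by (intro sum_nonneg) (simp add: less_imp_le)
  have "a n \<le> (\<bar>B\<bar> + S + 1) * b n" if n: "n \<ge> k" for n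
  proof (cases "n < N")
    case True
    have "\<bar>a n\<bar> / b n \<le> S"
      unfolding S_def using True n assms(2) by (intro member_le_sum) (auto simp: less_imp_le)
    then have "\<bar>a n\<bar> \<le> S * b n" using assms(2)[OF n] by (simp add: field_simps)
    also have "\<dots> \<le> (\<bar>B\<bar> + S + 1) * b n" using assms(2)[OF n] by (intro mult_right_mono) auto
    finally show ?thesis by simp
  next
    case False
    then have "a n \<le> B * b n" using N by simp
    also have "\<dots> \<le> (\<bar>B\<bar> + S + 1) * b n" using assms(2)[OF n] S by (intro mult_right_mono) auto
    finally show ?thesis .
  qed
  then have "a n \<le> \<gamma>' * b n" if "\<bar>B\<bar> + S + 1 \<le> \<gamma>'" "n \<ge> k" for \<gamma>' n
    using that assms(2)[of n] mult_right_mono[OF that(1), of "b n"] by (meson less_imp_le order_trans)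
  then show ?thesis using S by (intro exI[of _ "\<bar>B\<bar> + S + 1"]) auto
qed

section \<open>Descent sequences and the Kurdyka-Lojasiewicz inequality\<close>

text \<open>\<open>E\<close> stands for the excess of the energy over its limit. The convergence
  analysis sees the iterates only through these inequalities and is independent of how they are
  generated.\<close>

locale descent_sequence =
  fixes X :: "nat \<Rightarrow> 'a::euclidean_space" and E :: "nat \<Rightarrow> real" and \<delta> K :: real
  assumes E_nonneg: "0 \<le> E n"
    and descent: "E (Suc n) + \<delta> * (norm (X (Suc n) - X n))\<^sup>2 \<le> E n"
    and E_tendsto: "E \<longlonglongrightarrow> 0"
    and pos: "0 < \<delta>" "0 < K"
begin

definition d :: "nat \<Rightarrow> real" where "d n = norm (X (Suc n) - X n)"

lemma d_nonneg: "0 \<le> d n"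
  by (simp add: d_def)

lemma E_decreasing: "m \<le> n \<Longrightarrow> E n \<le> E m"
proof (rule lift_Suc_antimono_le[of E])
  show "E (Suc n) \<le> E n" for n
    using descent[of n] pos by (smt (verit) mult_nonneg_nonneg zero_le_power2)
qed

lemma d_sq_le: "\<delta> * (d n)\<^sup>2 \<le> E n - E (Suc n)"
  using descent[of n] by (simp add: d_def)

lemma d_le: "d n \<le> (E n / \<delta>) powr (1 / 2)"
proof -
  have "(d n)\<^sup>2 \<le> E n / \<delta>"
    using d_sq_le[of n] E_nonneg[of "Suc n"] pos by (simp add: field_simps)
  then have "d n \<le> sqrt (E n / \<delta>)"
    by (rule real_le_rsqrt)
  then show ?thesis
    using E_nonneg[of n] pos by (simp add: powr_half_sqrt)
qed

lemma d_tendsto: "d \<longlonglongrightarrow> 0"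
proof (rule tendsto_sandwich[of "\<lambda>_. 0" d sequentially "\<lambda>n. sqrt (E n / \<delta>)"])
  have "(\<lambda>n. sqrt (E n / \<delta>)) \<longlonglongrightarrow> sqrt (0 / \<delta>)"
    using pos by (intro tendsto_intros E_tendsto) auto
  then show "(\<lambda>n. sqrt (E n / \<delta>)) \<longlonglongrightarrow> 0" by simp
  show "\<forall>\<^sub>F n in sequentially. d n \<le> sqrt (E n / \<delta>)"
    using d_le E_nonneg pos by (auto simp: powr_half_sqrt)
qed (auto simp: d_nonneg)

lemma dist_le_sum: "n \<le> m \<Longrightarrow> dist (X (m + 2)) (X (n + 2)) \<le> (\<Sum>k=n..<m. d (k + 2))"
proof (induction m rule: dec_induct)
  case (step m)
  have "dist (X (Suc m + 2)) (X (n + 2)) \<le> dist (X (Suc m + 2)) (X (m + 2)) + dist (X (m + 2)) (X (n + 2))"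
    by (rule dist_triangle)
  also have "dist (X (Suc m + 2)) (X (m + 2)) = d (m + 2)"
    by (simp add: d_def dist_norm)
  finally show ?case using step by simp
qed simp

end

text \<open>\<open>KL_ineq\<close> is the Kurdyka-Lojasiewicz inequality already combined with the
  subgradient bound. In the application \<open>E m\<close> belongs to the pair
  \<open>(X m, X (m - 1))\<close>, and the subgradient there involves \<open>d (m - 1)\<close> and
  \<open>d (m - 2)\<close>; writing \<open>m = n + 2\<close> avoids subtraction.\<close>

locale KL_descent_sequence = descent_sequence +
  fixes xs and \<phi> \<phi>' :: "real \<Rightarrow> real" and \<eta> :: ereal and V :: "('a \<times> 'a) set"
  assumes \<eta>: "0 < \<eta>" and V: "open V" "(xs, xs) \<in> V"
    and \<phi>_cont: "continuous_on {t. 0 \<le> t \<and> ereal t < \<eta>} \<phi>"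
    and \<phi>_concave: "concave_on {t. 0 \<le> t \<and> ereal t < \<eta>} \<phi>"
    and \<phi>_nonneg: "\<And>t. 0 \<le> t \<Longrightarrow> ereal t < \<eta> \<Longrightarrow> 0 \<le> \<phi> t"
    and \<phi>_0: "\<phi> 0 = 0"
    and \<phi>_deriv: "\<And>t. 0 < t \<Longrightarrow> ereal t < \<eta> \<Longrightarrow> (\<phi> has_real_derivative \<phi>' t) (at t)"
    and \<phi>'_pos: "\<And>t. 0 < t \<Longrightarrow> ereal t < \<eta> \<Longrightarrow> 0 < \<phi>' t"
    and KL_ineq: "\<And>n. (X (n + 2), X (n + 1)) \<in> V \<Longrightarrow> 0 < E (n + 2) \<Longrightarrow> ereal (E (n + 2)) < \<eta> \<Longrightarrow>
      1 \<le> \<phi>' (E (n + 2)) * (K * (d (n + 1) + d n))"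
begin

abbreviation "M \<equiv> K / \<delta>"

lemma d_step:
  assumes "(X (n + 2), X (n + 1)) \<in> V" "ereal (E (n + 2)) < \<eta>"
  shows "d (n + 2) \<le> (d (n + 1) + d n) / 4 + (M * \<phi> (E (n + 2)) - M * \<phi> (E (Suc n + 2)))"
\<comment> \<open>At zero excess the KL inequality is silent, but then the energy cannot drop any
  further and the step vanishes.\<close>
proof (cases "E (n + 2) = 0")
  case True
  then have E3: "E (Suc n + 2) = 0"
    using E_decreasing[of "n + 2" "Suc n + 2"] E_nonneg[of "Suc n + 2"] by simp
  have "\<delta> * (d (n + 2))\<^sup>2 \<le> 0"
    using d_sq_le[of "n + 2"] E3 True by simp
  then have "d (n + 2) = 0"
    using pos by (simp add: mult_le_0_iff)
  then show ?thesis using True E3 d_nonneg[of n] d_nonneg[of "n + 1"] by simp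
next
  case False
  let ?E = "E (n + 2)" and ?E' = "E (Suc n + 2)"
  have E: "0 < ?E" "?E' \<le> ?E" "0 \<le> ?E'"
    using False E_nonneg[of "n + 2"] E_decreasing[of "n + 2" "Suc n + 2"] E_nonneg[of "Suc n + 2"]
    by simp_all
  then have \<eta>': "ereal ?E' < \<eta>"
    using assms by (meson ereal_less_eq(3) le_less_trans)
  define s t where "s = d (n + 1) + d n" and "t = M * (\<phi> ?E - \<phi> ?E')"
  have "\<phi> ?E' \<le> \<phi> ?E + \<phi>' ?E * (?E' - ?E)"
    using concave_on_below_tangent[OF \<phi>_concave \<phi>_deriv] E assms \<eta>' by blast
  then have tang: "\<phi>' ?E * (?E - ?E') \<le> \<phi> ?E - \<phi> ?E'"
    by (simp add: algebra_simps)
  have "\<phi>' ?E * (\<delta> * (d (n + 2))\<^sup>2) \<le> \<phi>' ?E * (?E - ?E')"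
    using d_sq_le[of "n + 2"] \<phi>'_pos[OF E(1) assms(2)] by (intro mult_left_mono) auto
  with tang have 1: "\<phi>' ?E * (\<delta> * (d (n + 2))\<^sup>2) \<le> \<phi> ?E - \<phi> ?E'"
    by simp
  have s0: "0 \<le> s" by (simp add: s_def d_nonneg)
  have "0 \<le> \<phi>' ?E * (?E - ?E')"
    using \<phi>'_pos[OF E(1) assms(2)] E by simp
  with tang have t0: "0 \<le> t" using pos by (simp add: t_def)
  have "\<delta> * (d (n + 2))\<^sup>2 * 1 \<le> \<delta> * (d (n + 2))\<^sup>2 * (\<phi>' ?E * (K * s))"
    using KL_ineq[OF assms(1) E(1) assms(2)] pos by (intro mult_left_mono) (auto simp: s_def)
  also have "\<dots> = (\<phi>' ?E * (\<delta> * (d (n + 2))\<^sup>2)) * (K * s)" by simp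
  also have "\<dots> \<le> (\<phi> ?E - \<phi> ?E') * (K * s)"
    using 1 s0 pos by (intro mult_right_mono) auto
  finally have "(d (n + 2))\<^sup>2 \<le> s * t"
    using pos by (simp add: t_def field_simps)
  \<comment> \<open>Arithmetic-geometric mean inequality for \<open>s / 4\<close> and
    \<open>t\<close>, since \<open>s * t = 4 * (s / 4) * t\<close>; the weights are chosen so that
    the old steps keep the factor 1/4.\<close>
  also have "\<dots> \<le> (s / 4 + t)\<^sup>2"
    using sum_squares_bound[of "s / 4" t] zero_le_power2[of "s / 4 - t"]
    by (simp add: power2_eq_square algebra_simps)
  finally have "d (n + 2) \<le> s / 4 + t"
    by (rule power2_le_imp_le) (use s0 t0 in simp)
  then show ?thesis unfolding s_def t_def right_diff_distrib .
qed

lemma E_eventually_less: "\<forall>\<^sub>F n in sequentially. ereal (E n) < \<eta>"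
  using E_tendsto \<eta> by (intro order_tendstoD(2)[of "\<lambda>n. ereal (E n)" 0]) (auto simp: zero_ereal_def)

lemma \<phi>_E_tendsto: "(\<lambda>n. \<phi> (E n)) \<longlonglongrightarrow> 0"
proof -
  have "\<forall>\<^sub>F n in sequentially. E n \<in> {t. 0 \<le> t \<and> ereal t < \<eta>}"
    using E_eventually_less
    by eventually_elim (simp add: E_nonneg)
  then have "(\<lambda>n. \<phi> (E n)) \<longlonglongrightarrow> \<phi> 0"
    using \<eta> by (intro continuous_on_tendsto_compose[OF \<phi>_cont E_tendsto]) (auto simp: zero_ereal_def)
  then show ?thesis by (simp add: \<phi>_0)
qed

lemma sum_d_le:
  assumes "n \<le> m" "\<And>k. n \<le> k \<Longrightarrow> k < m \<Longrightarrow> (X (k + 2), X (k + 1)) \<in> V"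
    "\<And>k. n \<le> k \<Longrightarrow> ereal (E (k + 2)) < \<eta>"
  shows "(\<Sum>k=n..<m. d (k + 2)) \<le> d (n + 1) + d n / 2 + 2 * (M * \<phi> (E (n + 2)))"
proof (rule sum_le_of_potential)
  show "0 \<le> M * \<phi> (E (m + 2))"
    using assms pos by (intro mult_nonneg_nonneg \<phi>_nonneg E_nonneg) auto
  show "d (k + 2) \<le> (d (k + 1) + d k) / 4 + (M * \<phi> (E (k + 2)) - M * \<phi> (E (Suc k + 2)))"
    if "n \<le> k" "k < m" for k
    using that assms by (intro d_step)
qed (use assms d_nonneg in auto)

text \<open>Started close enough to the cluster point, the iterates never leave \<open>V\<close>, because the length
  of the remaining path is controlled by quantities that are already small.\<close>

lemma eventually_in_V:
  assumes cluster: "strict_mono r" "(X \<circ> r) \<longlonglongrightarrow> xs"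
  shows "\<exists>N. \<forall>n\<ge>N. (X (n + 2), X (n + 1)) \<in> V \<and> ereal (E (n + 2)) < \<eta>"
proof -
  obtain \<epsilon>0 where "\<epsilon>0 > 0" "ball (xs, xs) \<epsilon>0 \<subseteq> V"
    using V by (meson open_contains_ball)
  \<comment> \<open>The product metric is at most the sum of the component distances, so each
    component gets half of the radius.\<close>
  define \<epsilon> where "\<epsilon> = \<epsilon>0 / 2"
  have \<epsilon>: "\<epsilon> > 0" using \<open>\<epsilon>0 > 0\<close> by (simp add: \<epsilon>_def)
  have inV: "(a, b) \<in> V" if "dist a xs < \<epsilon>" "dist b xs < \<epsilon>" for a b
  proof -
    have "dist (xs, xs) (a, b) \<le> dist xs a + dist xs b"
      unfolding dist_Pair_Pair by (rule sqrt_sum_squares_le_sum) auto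
    also have "\<dots> < \<epsilon>0" using that by (simp add: \<epsilon>_def dist_commute)
    finally show ?thesis using \<open>ball (xs, xs) \<epsilon>0 \<subseteq> V\<close> by auto
  qed
  have "(\<lambda>n. d (n + 1) + d n / 2 + 2 * (M * \<phi> (E (n + 2)))) \<longlonglongrightarrow> 0 + 0 / 2 + 2 * (M * 0)"
    by (intro tendsto_intros LIMSEQ_ignore_initial_segment d_tendsto \<phi>_E_tendsto) auto
  then have "\<forall>\<^sub>F n in sequentially. d (n + 1) + d n / 2 + 2 * (M * \<phi> (E (n + 2))) < \<epsilon> / 2"
    using \<epsilon> by (intro order_tendstoD(2)[where y = 0]) auto
  moreover have "\<forall>\<^sub>F n in sequentially. d (n + 1) < \<epsilon> / 2"
    using \<epsilon> LIMSEQ_ignore_initial_segment[OF d_tendsto, of 1] by (intro order_tendstoD(2)[where y = 0]) auto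
  moreover have "\<forall>\<^sub>F n in sequentially. ereal (E (n + 2)) < \<eta>"
    using E_eventually_less by (rule eventually_sequentially_seg[THEN iffD2])
  ultimately have "\<forall>\<^sub>F n in sequentially. d (n + 1) + d n / 2 + 2 * (M * \<phi> (E (n + 2))) < \<epsilon> / 2
      \<and> d (n + 1) < \<epsilon> / 2 \<and> ereal (E (n + 2)) < \<eta>"
    by eventually_elim simp
  then obtain N0 where N0: "\<And>n. n \<ge> N0 \<Longrightarrow> d (n + 1) + d n / 2 + 2 * (M * \<phi> (E (n + 2))) < \<epsilon> / 2
      \<and> d (n + 1) < \<epsilon> / 2 \<and> ereal (E (n + 2)) < \<eta>"
    by (auto simp: eventually_sequentially)
  obtain k0 where k0: "\<And>k. k \<ge> k0 \<Longrightarrow> dist (X (r k)) xs < \<epsilon> / 2"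
    using metric_LIMSEQ_D[OF cluster(2), of "\<epsilon> / 2"] \<epsilon> by auto
  \<comment> \<open>The choice gives \<open>r k \<ge> N0 + 2\<close>, so \<open>X (N + 2)\<close> is
    a point of the subsequence close to \<open>xs\<close>, and all smallness estimates hold from
    \<open>N\<close> on.\<close>
  define k N where "k = max k0 (N0 + 2)" and "N = r k - 2"
  have "r k \<ge> k" using cluster(1) by (rule seq_suble)
  then have N: "N \<ge> N0" "r k = N + 2" by (auto simp: k_def N_def)
  have X2: "dist (X (N + 2)) xs < \<epsilon> / 2"
    using k0[of k] N by (simp add: k_def)
  have "dist (X (N + 1)) xs \<le> dist (X (N + 1)) (X (N + 2)) + dist (X (N + 2)) xs"
    by (rule dist_triangle)
  also have "dist (X (N + 1)) (X (N + 2)) = d (N + 1)"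
    by (simp add: d_def dist_norm norm_minus_commute)
  finally have X1: "dist (X (N + 1)) xs < \<epsilon>"
    using X2 N0[of N] N by simp
  have "dist (X (n + 1)) xs < \<epsilon> \<and> dist (X (n + 2)) xs < \<epsilon>" if "n \<ge> N" for n
    using that
  proof (induction n rule: less_induct)
    case (less n)
    \<comment> \<open>By induction all pairs with index below \<open>n\<close> lie in
      \<open>V\<close>, so the length bound covers the path from \<open>X (N + 2)\<close> to
      \<open>X (n + 2)\<close>.\<close>
    have "(\<Sum>k=N..<n. d (k + 2)) \<le> d (N + 1) + d N / 2 + 2 * (M * \<phi> (E (N + 2)))"
      using less inV N0 N by (intro sum_d_le) auto
    with N0[of N] N dist_le_sum[OF less.prems] have "dist (X (n + 2)) (X (N + 2)) < \<epsilon> / 2"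
      by simp
    with X2 have 2: "dist (X (n + 2)) xs < \<epsilon>"
      using dist_triangle[of "X (n + 2)" xs "X (N + 2)"] by simp
    have 1: "dist (X (n + 1)) xs < \<epsilon>"
    proof (cases "n = N")
      case False
      then have "n - 1 < n" "n - 1 \<ge> N" "n - 1 + 2 = n + 1" using less.prems by auto
      then show ?thesis using less.IH[of "n - 1"] by simp
    qed (use X1 in simp)
    from 1 2 show ?case by simp
  qed
  then show ?thesis using inV N0 N by (intro exI[of _ N]) auto
qed

lemma summable_d:
  assumes cluster: "strict_mono r" "(X \<circ> r) \<longlonglongrightarrow> xs"
  shows "summable d"
proof -
  obtain N where N: "\<And>n. n \<ge> N \<Longrightarrow> (X (n + 2), X (n + 1)) \<in> V \<and> ereal (E (n + 2)) < \<eta>"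
    using eventually_in_V[OF cluster] by blast
  let ?B = "d (N + 1) + d N / 2 + 2 * (M * \<phi> (E (N + 2)))"
  have "summable (\<lambda>n. d (n + (N + 2)))"
  proof (rule bounded_imp_summable[where B = ?B])
    fix n
    have "(\<Sum>k\<le>n. d (k + (N + 2))) = (\<Sum>k=N..<Suc n + N. d (k + 2))"
      using sum.shift_bounds_nat_ivl[of "\<lambda>k. d (k + 2)" 0 N "Suc n"]
      by (simp add: atLeast0LessThan lessThan_Suc_atMost add.assoc)
    also have "\<dots> \<le> ?B"
      using N by (intro sum_d_le) auto
    finally show "(\<Sum>k\<le>n. d (k + (N + 2))) \<le> ?B" .
  qed (simp add: d_nonneg)
  then show ?thesis by (rule summable_iff_shift[THEN iffD1])
qed

text \<open>Summable step norms make the telescoping series of increments converge; its limit can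
  only be that of the subsequence.\<close>

lemma convergent_to_cluster:
  assumes cluster: "strict_mono r" "(X \<circ> r) \<longlonglongrightarrow> xs"
  shows "X \<longlonglongrightarrow> xs"
proof -
  have "summable (\<lambda>n. X (Suc n) - X n)"
    using summable_d[OF cluster] unfolding d_def[abs_def] by (rule summable_norm_cancel)
  then have "convergent (\<lambda>n. \<Sum>k<n. X (Suc k) - X k)"
    by (simp add: summable_iff_convergent)
  then have "convergent (\<lambda>n. X n - X 0)"
    by (simp add: sum_lessThan_telescope)
  then have "convergent X"
    by (rule convergent_diff_const_right_iff[THEN iffD1])
  then obtain L where L: "X \<longlonglongrightarrow> L" by (auto simp: convergent_def)
  then have "L = xs"
    using LIMSEQ_subseq_LIMSEQ[OF L cluster(1)] cluster(2) LIMSEQ_unique by blast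
  with L show ?thesis by simp
qed

text \<open>The path length bound from \<open>n\<close> to \<open>m\<close>, with \<open>m\<close>
  tending to infinity.\<close>

lemma tail_bound:
  assumes lim: "X \<longlonglongrightarrow> xs"
  shows "\<forall>\<^sub>F n in sequentially. norm (X (n + 2) - xs) \<le> d (n + 1) + d n / 2 + 2 * (M * \<phi> (E (n + 2)))"
proof -
  obtain N where N: "\<And>n. n \<ge> N \<Longrightarrow> (X (n + 2), X (n + 1)) \<in> V \<and> ereal (E (n + 2)) < \<eta>"
    \<comment> \<open>The whole sequence converges here, so it serves as its own
      subsequence.\<close>
    using eventually_in_V[of id] lim by (auto simp: strict_mono_id)
  have "norm (X (n + 2) - xs) \<le> d (n + 1) + d n / 2 + 2 * (M * \<phi> (E (n + 2)))" if "n \<ge> N" for n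
  proof -
    have "(\<lambda>m. dist (X (m + 2)) (X (n + 2))) \<longlonglongrightarrow> dist xs (X (n + 2))"
      by (intro tendsto_intros LIMSEQ_ignore_initial_segment lim)
    moreover have "\<forall>\<^sub>F m in sequentially. dist (X (m + 2)) (X (n + 2)) \<le> d (n + 1) + d n / 2 + 2 * (M * \<phi> (E (n + 2)))"
      using eventually_ge_at_top[of n]
    proof eventually_elim
      case (elim m)
      have "(\<Sum>k=n..<m. d (k + 2)) \<le> d (n + 1) + d n / 2 + 2 * (M * \<phi> (E (n + 2)))"
        using elim that N by (intro sum_d_le) auto
      with dist_le_sum[OF elim] show ?case by simp
    qed
    ultimately have "dist xs (X (n + 2)) \<le> d (n + 1) + d n / 2 + 2 * (M * \<phi> (E (n + 2)))"
      by (rule tendsto_upperbound) simp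
    then show ?thesis by (simp add: dist_norm norm_minus_commute)
  qed
  then show ?thesis by (auto simp: eventually_sequentially)
qed


section \<open>Rates for power-type desingularizing functions\<close>

context
  fixes c0 \<theta> :: real
  assumes power: "\<phi> = (\<lambda>t. c0 * t powr (1 - \<theta>))"
    and c0: "0 < c0" and \<theta>: "0 \<le> \<theta>" "\<theta> < 1"
    and lim: "X \<longlonglongrightarrow> xs"
begin

text \<open>The KL data supply \<open>\<phi>'\<close> only as some derivative of
  \<open>\<phi>\<close>; uniqueness of derivatives makes it explicit.\<close>

lemma \<phi>'_eq:
  assumes "0 < t" "ereal t < \<eta>"
  shows "\<phi>' t = c0 * (1 - \<theta>) * t powr (- \<theta>)"
proof -
  have "(\<phi> has_real_derivative c0 * ((1 - \<theta>) * t powr (1 - \<theta> - 1))) (at t)"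
    unfolding power using assms by (auto intro!: derivative_eq_intros)
  then show ?thesis using \<phi>_deriv[OF assms] DERIV_unique by fastforce
qed

lemma eventually_KL:
  "\<forall>\<^sub>F n in sequentially. 0 < E (n + 2) \<longrightarrow> E (n + 2) powr \<theta> \<le> c0 * (1 - \<theta>) * K * (d (n + 1) + d n)"
proof -
  obtain N where N: "\<And>n. n \<ge> N \<Longrightarrow> (X (n + 2), X (n + 1)) \<in> V \<and> ereal (E (n + 2)) < \<eta>"
    using eventually_in_V[of id] lim by (auto simp: strict_mono_id)
  have "E (n + 2) powr \<theta> \<le> c0 * (1 - \<theta>) * K * (d (n + 1) + d n)" if "n \<ge> N" "0 < E (n + 2)" for n
  proof -
    have "1 \<le> c0 * (1 - \<theta>) * E (n + 2) powr (- \<theta>) * (K * (d (n + 1) + d n))"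
      using KL_ineq[of n] \<phi>'_eq[of "E (n + 2)"] N[of n] that by simp
    then show ?thesis using that by (simp add: powr_minus field_simps)
  qed
  then show ?thesis by (auto simp: eventually_sequentially)
qed

text \<open>For exponent 0 the KL inequality keeps the sum of two consecutive steps away from zero
  while the excess is positive. The steps tend to zero, so the excess vanishes eventually, and
  descent then freezes the sequence.\<close>

lemma finite_termination:
  assumes "\<theta> = 0"
  shows "\<forall>\<^sub>F n in sequentially. X n = xs"
proof -
  have "(\<lambda>n. c0 * (1 - \<theta>) * K * (d (n + 1) + d n)) \<longlonglongrightarrow> c0 * (1 - \<theta>) * K * (0 + 0)"
    by (intro tendsto_intros LIMSEQ_ignore_initial_segment d_tendsto)
  then have "\<forall>\<^sub>F n in sequentially. c0 * (1 - \<theta>) * K * (d (n + 1) + d n) < 1"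
    by (intro order_tendstoD(2)[where y = 0]) auto
  with eventually_KL have "\<forall>\<^sub>F n in sequentially. E (n + 2) = 0"
  proof eventually_elim
    case (elim n)
    then show ?case using assms E_nonneg[of "n + 2"] by (cases "E (n + 2) = 0") auto
  qed
  then obtain N where N: "\<And>n. n \<ge> N \<Longrightarrow> E (n + 2) = 0"
    by (auto simp: eventually_sequentially)
  have "d (n + 2) = 0" if "n \<ge> N" for n
    using d_sq_le[of "n + 2"] N[OF that] N[of "Suc n"] that pos by (simp add: mult_le_0_iff)
  then have *: "X (Suc (n + 2)) = X (n + 2)" if "n \<ge> N" for n
    using that by (simp add: d_def)
  have const: "X (n + 2) = X (N + 2)" if "n \<ge> N" for n
    using that by (induction n rule: dec_induct) (use * in auto)
  have "(\<lambda>n. X (n + 2)) \<longlonglongrightarrow> X (N + 2)"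
    by (intro tendsto_eventually eventually_sequentiallyI[of N] const)
  then have "xs = X (N + 2)"
    by (rule LIMSEQ_unique[OF LIMSEQ_ignore_initial_segment[OF lim]])
  then have "\<forall>\<^sub>F n in sequentially. X (n + 2) = xs"
    using const by (intro eventually_sequentiallyI[of N]) metis
  then show ?thesis by (rule eventually_sequentially_seg[THEN iffD1])
qed

text \<open>Squaring the KL inequality produces squared steps, which the descent inequality bounds
  by energy drops; over two indices these add up to \<open>E n - E (n + 2)\<close>.\<close>

lemma E_recursion:
  assumes "0 < \<theta>"
  shows "\<exists>L>0. \<forall>\<^sub>F n in sequentially. E (n + 2) powr (2 * \<theta>) \<le> L * (E n - E (n + 2))"
proof -
  define B where "B = c0 * (1 - \<theta>) * K"
  have B: "0 < B" using c0 \<theta> pos by (simp add: B_def)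
  have "\<forall>\<^sub>F n in sequentially. E (n + 2) powr (2 * \<theta>) \<le> (2 * B\<^sup>2 / \<delta>) * (E n - E (n + 2))"
    using eventually_KL
  proof eventually_elim
    case (elim n)
    show ?case
    proof (cases "E (n + 2) = 0")
      case True
      then show ?thesis using E_nonneg pos by simp
    next
      case False
      then have "0 < E (n + 2)" using E_nonneg[of "n + 2"] by simp
      then have "E (n + 2) powr \<theta> \<le> B * (d (n + 1) + d n)"
        using elim by (simp add: B_def)
      then have "(E (n + 2) powr \<theta>)\<^sup>2 \<le> (B * (d (n + 1) + d n))\<^sup>2"
        by (intro power_mono) auto
      also have "\<dots> \<le> B\<^sup>2 * (2 * ((d (n + 1))\<^sup>2 + (d n)\<^sup>2))"
        unfolding power_mult_distrib using sum_squares_bound[of "d (n + 1)" "d n"]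
        by (intro mult_left_mono) (auto simp: power2_sum)
      also have "\<dots> = (2 * B\<^sup>2 / \<delta>) * (\<delta> * (d (n + 1))\<^sup>2 + \<delta> * (d n)\<^sup>2)"
        using pos by (simp add: field_simps)
      also have "\<dots> \<le> (2 * B\<^sup>2 / \<delta>) * (E n - E (n + 2))"
        using d_sq_le[of n] d_sq_le[of "n + 1"] pos by (intro mult_left_mono) auto
      finally show ?thesis
        by (simp add: power2_eq_square flip: powr_add)
    qed
  qed
  then show ?thesis using B pos by (intro exI[of _ "2 * B\<^sup>2 / \<delta>"]) auto
qed

text \<open>In the tail bound the steps are of order \<open>E powr (1 / 2)\<close> and
  \<open>\<phi>\<close> contributes \<open>E powr (1 - \<theta>)\<close>. Once
  \<open>E n < 1\<close> the smaller exponent dominates, hence the two upper bounds on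
  \<open>q\<close>.\<close>

lemma norm_le_E_powr:
  assumes q: "0 < q" "q \<le> 1 / 2" "q \<le> 1 - \<theta>"
  shows "\<exists>L>0. \<forall>\<^sub>F n in sequentially. norm (X (n + 2) - xs) \<le> L * E n powr q"
proof -
  define L where "L = 2 * (1 / \<delta>) powr (1 / 2) + 2 * M * c0"
  have "\<forall>\<^sub>F n in sequentially. E n < 1"
    using E_tendsto by (rule order_tendstoD) simp
  with tail_bound[OF lim] have "\<forall>\<^sub>F n in sequentially. norm (X (n + 2) - xs) \<le> L * E n powr q"
  proof eventually_elim
    case (elim n)
    have mono: "E m powr r \<le> E n powr q" if "m \<ge> n" "q \<le> r" for m r
    proof -
      have "E m powr r \<le> E n powr r"
        using E_decreasing[OF that(1)] E_nonneg that q by (intro powr_mono2) auto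
      also have "\<dots> \<le> E n powr q"
        using that elim E_nonneg[of n] by (intro powr_mono') auto
      finally show ?thesis .
    qed
    have dle: "d m \<le> (1 / \<delta>) powr (1 / 2) * E n powr q" if "m \<ge> n" for m
    proof -
      have "d m \<le> (1 / \<delta>) powr (1 / 2) * E m powr (1 / 2)"
        using d_le[of m] E_nonneg[of m] pos by (simp add: powr_divide)
      also have "\<dots> \<le> (1 / \<delta>) powr (1 / 2) * E n powr q"
        using mono[OF that, of "1 / 2"] q by (intro mult_left_mono) auto
      finally show ?thesis .
    qed
    have "d (n + 1) + d n / 2 \<le> d (n + 1) + d n"
      using d_nonneg[of n] by simp
    also have "\<dots> \<le> 2 * (1 / \<delta>) powr (1 / 2) * E n powr q"
      using dle[of n] dle[of "n + 1"] by simp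
    finally have 1: "d (n + 1) + d n / 2 \<le> 2 * (1 / \<delta>) powr (1 / 2) * E n powr q" .
    have "2 * M * c0 * E (n + 2) powr (1 - \<theta>) \<le> 2 * M * c0 * E n powr q"
      using mono[of "n + 2" "1 - \<theta>"] q pos c0 by (intro mult_left_mono) auto
    then have "2 * (M * \<phi> (E (n + 2))) \<le> 2 * M * c0 * E n powr q"
      by (simp add: power mult.assoc)
    with elim(1) 1 have "norm (X (n + 2) - xs) \<le> 2 * (1 / \<delta>) powr (1 / 2) * E n powr q + 2 * M * c0 * E n powr q"
      by (rule order.trans[OF _ add_mono])
    then show ?case by (simp only: L_def distrib_right)
  qed
  moreover have "0 < L" using pos c0 by (simp add: L_def add_pos_pos)
  ultimately show ?thesis by blast
qed

text \<open>With \<open>2 * \<theta> \<le> 1\<close> and excess below 1,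
  \<open>E (n + 2) \<le> E (n + 2) powr (2 * \<theta>)\<close>, so the recursion becomes
  linear.\<close>

lemma linear_rate:
  assumes "0 < \<theta>" "\<theta> \<le> 1 / 2"
  shows "\<exists>\<gamma> \<rho>. 0 < \<gamma> \<and> 0 < \<rho> \<and> \<rho> < 1 \<and> (\<forall>\<^sub>F n in sequentially.
    norm (X (n + 2) - xs) \<le> \<gamma> * \<rho> powr (real n / 2) \<and> E n \<le> \<gamma> * \<rho> ^ n)"
proof -
  obtain L where L: "0 < L"
    "\<forall>\<^sub>F n in sequentially. E (n + 2) powr (2 * \<theta>) \<le> L * (E n - E (n + 2))"
    using E_recursion assms by blast
  have "\<forall>\<^sub>F n in sequentially. E n < 1"
    using E_tendsto by (rule order_tendstoD) simp
  with L(2) have "\<forall>\<^sub>F n in sequentially. E (n + 2) \<le> L * (E n - E (n + 2))"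
  proof eventually_elim
    case (elim n)
    have "E (n + 2) powr 1 \<le> E (n + 2) powr (2 * \<theta>)"
      using assms E_nonneg elim E_decreasing[of n "n + 2"] by (intro powr_mono') auto
    with elim show ?case using E_nonneg[of "n + 2"] by simp
  qed
  from geometric_decay[OF E_nonneg this L(1)] obtain C \<rho> where
    C: "0 < C" "0 < \<rho>" "\<rho> < 1" "\<forall>\<^sub>F n in sequentially. E n \<le> C * \<rho> ^ n"
    by blast
  obtain L' where L': "0 < L'" "\<forall>\<^sub>F n in sequentially. norm (X (n + 2) - xs) \<le> L' * E n powr (1 / 2)"
    using norm_le_E_powr[of "1 / 2"] assms by auto
  define \<gamma> where "\<gamma> = C + L' * C powr (1 / 2)"
  have \<gamma>: "C \<le> \<gamma>" "L' * C powr (1 / 2) \<le> \<gamma>" using C L' by (auto simp: \<gamma>_def)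
  have "\<forall>\<^sub>F n in sequentially. norm (X (n + 2) - xs) \<le> \<gamma> * \<rho> powr (real n / 2) \<and> E n \<le> \<gamma> * \<rho> ^ n"
    using C(4) L'(2)
  proof eventually_elim
    case (elim n)
    have "L' * E n powr (1 / 2) \<le> L' * (C * \<rho> ^ n) powr (1 / 2)"
      using elim E_nonneg L' by (intro mult_left_mono powr_mono2) auto
    also have "\<dots> = (L' * C powr (1 / 2)) * \<rho> powr (real n / 2)"
      using C by (simp add: powr_mult powr_powr flip: powr_realpow)
    also have "\<dots> \<le> \<gamma> * \<rho> powr (real n / 2)"
      using \<gamma> by (intro mult_right_mono) auto
    finally have "norm (X (n + 2) - xs) \<le> \<gamma> * \<rho> powr (real n / 2)" using elim by simp
    moreover have "C * \<rho> ^ n \<le> \<gamma> * \<rho> ^ n" using \<gamma> C by (intro mult_right_mono) auto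
    ultimately show ?case using elim by simp
  qed
  with C \<gamma> show ?thesis by (intro exI[of _ \<gamma>] exI[of _ \<rho>]) auto
qed

lemma sublinear_rate:
  assumes "1 / 2 < \<theta>"
  shows "\<exists>\<gamma>>0. \<forall>\<^sub>F n in sequentially.
    norm (X (n + 2) - xs) \<le> \<gamma> * real n powr (- ((1 - \<theta>) / (2 * \<theta> - 1))) \<and>
    E n \<le> \<gamma> * real n powr (- ((2 - 2 * \<theta>) / (2 * \<theta> - 1)))"
proof -
  obtain L where L: "0 < L"
    "\<forall>\<^sub>F n in sequentially. E (n + 2) powr (2 * \<theta>) \<le> L * (E n - E (n + 2))"
    using E_recursion assms by auto
  from polynomial_decay[OF E_nonneg L(2) L(1)] assms obtain C where
    C: "0 < C" "\<forall>\<^sub>F n in sequentially. E n \<le> C * real n powr (- (1 / (2 * \<theta> - 1)))"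
    by auto
  obtain L' where L': "0 < L'" "\<forall>\<^sub>F n in sequentially. norm (X (n + 2) - xs) \<le> L' * E n powr (1 - \<theta>)"
    using norm_le_E_powr[of "1 - \<theta>"] assms \<theta> by auto
  define \<gamma> where "\<gamma> = C + L' * C powr (1 - \<theta>)"
  have \<gamma>: "C \<le> \<gamma>" "L' * C powr (1 - \<theta>) \<le> \<gamma>" using C L' by (auto simp: \<gamma>_def)
  have "\<forall>\<^sub>F n in sequentially.
    norm (X (n + 2) - xs) \<le> \<gamma> * real n powr (- ((1 - \<theta>) / (2 * \<theta> - 1))) \<and>
    E n \<le> \<gamma> * real n powr (- ((2 - 2 * \<theta>) / (2 * \<theta> - 1)))"
    using C(2) L'(2) eventually_ge_at_top[of 1]
  proof eventually_elim
    case (elim n)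
    have "L' * E n powr (1 - \<theta>) \<le> L' * (C * real n powr (- (1 / (2 * \<theta> - 1)))) powr (1 - \<theta>)"
      using elim E_nonneg L' \<theta> by (intro mult_left_mono powr_mono2) auto
    also have "\<dots> = (L' * C powr (1 - \<theta>)) * real n powr (- ((1 - \<theta>) / (2 * \<theta> - 1)))"
      using C by (simp add: powr_mult powr_powr)
    also have "\<dots> \<le> \<gamma> * real n powr (- ((1 - \<theta>) / (2 * \<theta> - 1)))"
      using \<gamma> by (intro mult_right_mono) auto
    finally have "norm (X (n + 2) - xs) \<le> \<gamma> * real n powr (- ((1 - \<theta>) / (2 * \<theta> - 1)))"
      using elim by simp
    \<comment> \<open>Here \<open>2 - 2 * \<theta> < 1\<close>, so the decay obtained from the
      recursion is faster than the one claimed.\<close>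
    moreover have "C * real n powr (- (1 / (2 * \<theta> - 1))) \<le> \<gamma> * real n powr (- ((2 - 2 * \<theta>) / (2 * \<theta> - 1)))"
      using \<gamma> C elim assms by (intro mult_mono powr_mono le_imp_neg_le divide_right_mono) auto
    ultimately show ?case using elim by simp
  qed
  with C \<gamma> show ?thesis by (intro exI[of _ \<gamma>]) auto
qed

end

end

section \<open>Frechet subgradients\<close>

lemma gderiv_eventually_le:
  fixes q :: "'a::euclidean_space \<Rightarrow> real"
  assumes "GDERIV q x :> D" "0 < e"
  shows "\<forall>\<^sub>F y in nhds x. \<bar>q y - q x - D \<bullet> (y - x)\<bar> \<le> e * norm (y - x)"
proof -
  have "(q has_derivative (\<lambda>h. inner h D)) (at x)"
    using assms(1) by (simp add: gderiv_def)
  then obtain r where "0 < r" "\<And>y. norm (y - x) < r \<Longrightarrow>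
      norm (q y - q x - inner (y - x) D) \<le> e * norm (y - x)"
    unfolding has_derivative_at_alt using assms(2) by blast
  then show ?thesis
    unfolding eventually_nhds_metric
    by (intro exI[of _ r]) (auto simp: dist_norm inner_commute)
qed

text \<open>Trades the extended-real quotient for one inequality per \<open>e\<close>. This
  inequality also holds at \<open>y = x\<close>, so the punctured filter becomes
  \<open>nhds x\<close>.\<close>

lemma frechet_subdiff_iff:
  fixes \<phi> :: "'a::euclidean_space \<Rightarrow> ereal"
  shows "s \<in> frechet_subdiff \<phi> x \<longleftrightarrow> \<bar>\<phi> x\<bar> \<noteq> \<infinity> \<and>
    (\<forall>e>0. \<forall>\<^sub>F y in nhds x. \<phi> x + ereal (s \<bullet> (y - x) - e * norm (y - x)) \<le> \<phi> y)"
proof (cases "\<bar>\<phi> x\<bar> = \<infinity>")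
  case False
  then obtain a where a: "\<phi> x = ereal a" by auto
  have iff: "- ereal e \<le> (\<phi> y - \<phi> x - ereal (s \<bullet> (y - x))) / ereal (norm (y - x))
      \<longleftrightarrow> \<phi> x + ereal (s \<bullet> (y - x) - e * norm (y - x)) \<le> \<phi> y" if "y \<noteq> x" for e y
    using that a by (cases "\<phi> y") (auto simp: field_simps)
  have "0 \<le> Liminf (at x) (\<lambda>y. (\<phi> y - \<phi> x - ereal (s \<bullet> (y - x))) / ereal (norm (y - x)))
     \<longleftrightarrow> (\<forall>e>0. \<forall>\<^sub>F y in at x. - ereal e \<le> (\<phi> y - \<phi> x - ereal (s \<bullet> (y - x))) / ereal (norm (y - x)))"
    (is "0 \<le> Liminf _ ?Q \<longleftrightarrow> ?R")
  proof
    assume L: "0 \<le> Liminf (at x) ?Q"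
    show ?R
    proof (intro allI impI)
      fix e :: real assume "e > 0"
      then have "- ereal e < 0" by (simp add: zero_ereal_def)
      then have "\<forall>\<^sub>F y in at x. - ereal e < ?Q y"
        using L unfolding le_Liminf_iff by blast
      then show "\<forall>\<^sub>F y in at x. - ereal e \<le> ?Q y"
        by eventually_elim simp
    qed
  next
    assume R: ?R
    show "0 \<le> Liminf (at x) ?Q"
      unfolding le_Liminf_iff
    proof (intro allI impI)
      fix y :: ereal assume "y < 0"
      \<comment> \<open>\<open>y\<close> may be \<open>-\<infinity>\<close>; a real number strictly
        between it and 0 serves as \<open>- e\<close>.\<close>
      then obtain z where z: "y < ereal z" "ereal z < 0"
        using ereal_dense2 by blast
      then have "0 < - z" by (simp add: zero_ereal_def)
      then have "\<forall>\<^sub>F w in at x. - ereal (- z) \<le> ?Q w"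
        by (rule R[rule_format])
      then show "\<forall>\<^sub>F w in at x. y < ?Q w"
        by (rule eventually_mono) (use z(1) in \<open>simp add: less_le_trans\<close>)
    qed
  qed
  also have "\<dots> \<longleftrightarrow> (\<forall>e>0. \<forall>\<^sub>F y in at x. \<phi> x + ereal (s \<bullet> (y - x) - e * norm (y - x)) \<le> \<phi> y)"
  proof -
    have "(\<forall>\<^sub>F y in at x. - ereal e \<le> (\<phi> y - \<phi> x - ereal (s \<bullet> (y - x))) / ereal (norm (y - x)))
      \<longleftrightarrow> (\<forall>\<^sub>F y in at x. \<phi> x + ereal (s \<bullet> (y - x) - e * norm (y - x)) \<le> \<phi> y)" for e
      unfolding eventually_at_filter
      by (rule eventually_subst, rule always_eventually) (use iff in blast)
    then show ?thesis by simp
  qed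
  also have "\<dots> \<longleftrightarrow> (\<forall>e>0. \<forall>\<^sub>F y in nhds x. \<phi> x + ereal (s \<bullet> (y - x) - e * norm (y - x)) \<le> \<phi> y)"
    by (simp add: eventually_nhds_conv_at a)
  finally show ?thesis
    using False by (auto simp: frechet_subdiff_def)
qed (auto simp: frechet_subdiff_def)

lemma frechet_subdiffD:
  fixes \<phi> :: "'a::euclidean_space \<Rightarrow> ereal"
  assumes "s \<in> frechet_subdiff \<phi> x" "0 < e"
  shows "\<forall>\<^sub>F y in nhds x. \<phi> x + ereal (s \<bullet> (y - x) - e * norm (y - x)) \<le> \<phi> y"
  using assms unfolding frechet_subdiff_iff by blast

lemma frechet_subset_limiting: "frechet_subdiff \<phi> x \<subseteq> limiting_subdiff \<phi> x"
proof
  fix s assume "s \<in> frechet_subdiff \<phi> x"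
  moreover from this have "\<bar>\<phi> x\<bar> < \<infinity>" by (simp add: frechet_subdiff_def)
  ultimately show "s \<in> limiting_subdiff \<phi> x"
    unfolding limiting_subdiff_def mem_Collect_eq
    by (intro conjI exI[of _ "\<lambda>_. x"] exI[of _ "\<lambda>_. s"] allI tendsto_const)
qed

lemma dist0_le: "s \<in> S \<Longrightarrow> dist0 S \<le> ereal (norm s)"
  unfolding dist0_def by (rule INF_lower)

text \<open>An inequality near \<open>x\<close> with equality at \<open>x\<close> suffices to carry
  over a lower bound. This matters where \<open>\<psi>\<close> is infinite and a \<open>q\<close>
  built with \<open>real_of_ereal\<close> has arbitrary values.\<close>

lemma frechet_subdiff_add:
  fixes \<phi> \<psi> :: "'a::euclidean_space \<Rightarrow> ereal"
  assumes s: "s \<in> frechet_subdiff \<phi> x" and q: "GDERIV q x :> D"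
    and eq: "\<psi> x = \<phi> x + ereal (q x)"
    and le: "\<forall>\<^sub>F y in nhds x. \<phi> y + ereal (q y) \<le> \<psi> y"
  shows "s + D \<in> frechet_subdiff \<psi> x"
proof -
  obtain a where a: "\<phi> x = ereal a"
    using s by (auto simp: frechet_subdiff_iff)
  show ?thesis
    unfolding frechet_subdiff_iff
  proof (intro conjI allI impI)
    fix e :: real assume "e > 0"
    then have "\<forall>\<^sub>F y in nhds x. \<phi> x + ereal (s \<bullet> (y - x) - e / 2 * norm (y - x)) \<le> \<phi> y"
      by (intro frechet_subdiffD[OF s]) simp
    moreover have "\<forall>\<^sub>F y in nhds x. \<bar>q y - q x - D \<bullet> (y - x)\<bar> \<le> e / 2 * norm (y - x)"
      using gderiv_eventually_le[OF q, of "e / 2"] \<open>e > 0\<close> by simp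
    ultimately show "\<forall>\<^sub>F y in nhds x. \<psi> x + ereal ((s + D) \<bullet> (y - x) - e * norm (y - x)) \<le> \<psi> y"
      using le
    proof eventually_elim
      case (elim y)
      have "\<psi> x + ereal ((s + D) \<bullet> (y - x) - e * norm (y - x))
          \<le> (\<phi> x + ereal (s \<bullet> (y - x) - e / 2 * norm (y - x))) + ereal (q y)"
      proof -
        have "D \<bullet> (y - x) - e / 2 * norm (y - x) \<le> q y - q x"
          using elim(2) unfolding abs_le_iff by linarith
        then have "a + q x + ((s + D) \<bullet> (y - x) - e * norm (y - x))
            \<le> a + (s \<bullet> (y - x) - e / 2 * norm (y - x)) + q y"
          unfolding inner_add_left by linarith
        then show ?thesis by (simp only: eq a plus_ereal.simps ereal_less_eq)
      qed
      also have "\<dots> \<le> \<phi> y + ereal (q y)"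
        using elim(1) by (rule add_right_mono)
      finally show ?case using elim(3) by simp
    qed
  qed (simp add: eq a)
qed

lemma argmin_on_frechet:
  fixes \<psi> :: "'a::euclidean_space \<Rightarrow> ereal"
  assumes "x \<in> argmin_on C \<psi>" "\<And>y. \<psi> y \<noteq> -\<infinity>"
  shows "0 \<in> frechet_subdiff (\<lambda>y. \<psi> y + indicat_inf C y) x"
proof -
  have "\<psi> x < \<infinity>" "x \<in> C" "\<And>y. y \<in> C \<Longrightarrow> \<psi> x \<le> \<psi> y"
    using assms by (auto simp: argmin_on_def)
  then obtain a where a: "\<psi> x = ereal a" using assms(2)[of x] by (cases "\<psi> x") auto
  show ?thesis
    unfolding frechet_subdiff_iff
  proof (intro conjI allI impI always_eventually)
    fix e :: real and y assume "e > 0"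
    have "ereal a + ereal (0 \<bullet> (y - x) - e * norm (y - x)) \<le> ereal a"
      using \<open>e > 0\<close> by simp
    also have "ereal a \<le> \<psi> y + indicat_inf C y"
      using \<open>\<And>y. y \<in> C \<Longrightarrow> \<psi> x \<le> \<psi> y\<close> a assms(2) by (auto simp: indicat_inf_def)
    finally show "\<psi> x + indicat_inf C x + ereal (0 \<bullet> (y - x) - e * norm (y - x)) \<le> \<psi> y + indicat_inf C y"
      using \<open>x \<in> C\<close> by (simp add: indicat_inf_def a)
  qed (use \<open>x \<in> C\<close> in \<open>simp add: indicat_inf_def a\<close>)
qed

lemma gderiv_sq_dist:
  fixes c :: real and p :: "'a::euclidean_space"
  shows "GDERIV (\<lambda>y. c * (norm (y - p))\<^sup>2) y :> (2 * c) *\<^sub>R (y - p)"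
proof -
  have "((\<lambda>y. c * ((y - p) \<bullet> (y - p))) has_derivative (\<lambda>h. c * ((y - p) \<bullet> (h - 0) + (h - 0) \<bullet> (y - p)))) (at y)"
    by (intro derivative_intros)
  then show ?thesis
    unfolding gderiv_def power2_norm_eq_inner
    by (rule has_derivative_eq_rhs) (simp add: fun_eq_iff inner_commute)
qed

text \<open>As a function of the pair, \<open>\<phi>\<close> ignores the second variable, so
  \<open>(s, 0)\<close> is a subgradient; the coupling term is smooth and adds its gradient.\<close>

lemma frechet_subdiff_coupled:
  fixes \<phi> :: "'a::euclidean_space \<Rightarrow> ereal"
  assumes "s \<in> frechet_subdiff \<phi> x"
  shows "(s + (2 * c) *\<^sub>R (x - y), (2 * c) *\<^sub>R (y - x))
    \<in> frechet_subdiff (\<lambda>(u, v). \<phi> u + ereal (c * (norm (u - v))\<^sup>2)) (x, y)"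
proof -
  have "(s, 0) \<in> frechet_subdiff (\<lambda>(u, v). \<phi> u) (x, y)"
    unfolding frechet_subdiff_iff
  proof (intro conjI allI impI)
    show "\<bar>case (x, y) of (u, v) \<Rightarrow> \<phi> u\<bar> \<noteq> \<infinity>"
      using assms by (simp add: frechet_subdiff_iff)
    fix e :: real assume "e > 0"
    have "filterlim fst (nhds x) (nhds (x, y))"
      using tendsto_fst[OF filterlim_ident, of "(x, y)"] by (simp add: filterlim_ident)
    moreover have "\<forall>\<^sub>F u in nhds x. \<phi> x + ereal (s \<bullet> (u - x) - e * norm (u - x)) \<le> \<phi> u"
      using assms \<open>e > 0\<close> by (rule frechet_subdiffD)
    ultimately have "\<forall>\<^sub>F w in nhds (x, y). \<phi> x + ereal (s \<bullet> (fst w - x) - e * norm (fst w - x)) \<le> \<phi> (fst w)"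
      by (rule eventually_compose_filterlim[rotated])
    then show "\<forall>\<^sub>F w in nhds (x, y). (case (x, y) of (u, v) \<Rightarrow> \<phi> u) +
        ereal ((s, 0) \<bullet> (w - (x, y)) - e * norm (w - (x, y))) \<le> (case w of (u, v) \<Rightarrow> \<phi> u)"
    proof eventually_elim
      case (elim w)
      obtain u v where w: "w = (u, v)" by (cases w)
      have "norm (fst w - x) \<le> norm (w - (x, y))"
        using norm_fst_le[of "u - x" "v - y"] by (simp add: w)
      then have "ereal ((s, 0) \<bullet> (w - (x, y)) - e * norm (w - (x, y)))
        \<le> ereal (s \<bullet> (fst w - x) - e * norm (fst w - x))"
        using \<open>e > 0\<close> by (simp add: w)
      then have "\<phi> x + ereal ((s, 0) \<bullet> (w - (x, y)) - e * norm (w - (x, y)))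
        \<le> \<phi> x + ereal (s \<bullet> (fst w - x) - e * norm (fst w - x))"
        by (rule add_left_mono)
      with elim show ?case by (simp add: w)
    qed
  qed
  moreover have "GDERIV (\<lambda>w. c * (norm (fst w - snd w))\<^sup>2) (x, y) :> ((2 * c) *\<^sub>R (x - y), (2 * c) *\<^sub>R (y - x))"
  proof -
    have "((\<lambda>w. c * ((fst w - snd w) \<bullet> (fst w - snd w))) has_derivative
      (\<lambda>h. c * ((fst (x, y) - snd (x, y)) \<bullet> (fst h - snd h) + (fst h - snd h) \<bullet> (fst (x, y) - snd (x, y))))) (at (x, y))"
      by (intro derivative_intros)
    then show ?thesis
      unfolding gderiv_def power2_norm_eq_inner
      by (rule has_derivative_eq_rhs)
        (simp add: fun_eq_iff inner_commute inner_diff_left inner_diff_right algebra_simps)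
  qed
  ultimately have "(s, 0) + ((2 * c) *\<^sub>R (x - y), (2 * c) *\<^sub>R (y - x))
      \<in> frechet_subdiff (\<lambda>(u, v). \<phi> u + ereal (c * (norm (u - v))\<^sup>2)) (x, y)"
    by (rule frechet_subdiff_add) (auto simp: case_prod_beta)
  then show ?thesis by simp
qed

lemma descent_lemma:
  fixes h :: "'b::euclidean_space \<Rightarrow> real"
  assumes h: "\<And>y. GDERIV h y :> gh y" and lip: "l-lipschitz_on UNIV gh"
  shows "h y \<le> h x + gh x \<bullet> (y - x) + l / 2 * (norm (y - x))\<^sup>2"
proof -
  define e where "e = y - x"
  \<comment> \<open>\<open>\<psi>\<close> is \<open>h\<close> along the segment minus its quadratic
    upper model, so the claim is \<open>\<psi> 1 \<le> \<psi> 0\<close>; the Lipschitz bound makes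
    its derivative nonpositive.\<close>
  define \<psi> where "\<psi> t = h (x + t *\<^sub>R e) - t * (gh x \<bullet> e) - l * t\<^sup>2 / 2 * (norm e)\<^sup>2" for t
  have "(\<psi> has_real_derivative (gh (x + t *\<^sub>R e) \<bullet> e - gh x \<bullet> e - l * t * (norm e)\<^sup>2)) (at t)" for t
  proof -
    have "(h has_derivative (\<lambda>v. v \<bullet> gh (x + t *\<^sub>R e))) (at (x + t *\<^sub>R e))"
      using h by (simp add: gderiv_def)
    moreover have "((\<lambda>t. x + t *\<^sub>R e) has_derivative (\<lambda>r. r *\<^sub>R e)) (at t)"
      by (auto intro!: derivative_eq_intros)
    ultimately have "((\<lambda>t. h (x + t *\<^sub>R e)) has_derivative (\<lambda>r. r *\<^sub>R e \<bullet> gh (x + t *\<^sub>R e))) (at t)"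
      by (rule has_derivative_compose[rotated])
    then have "((\<lambda>t. h (x + t *\<^sub>R e)) has_real_derivative (gh (x + t *\<^sub>R e) \<bullet> e)) (at t)"
      unfolding has_field_derivative_def
      by (rule has_derivative_eq_rhs) (simp add: fun_eq_iff inner_commute)
    moreover have "((\<lambda>t. t * (gh x \<bullet> e)) has_real_derivative gh x \<bullet> e) (at t)"
      by (auto intro!: derivative_eq_intros)
    moreover have "((\<lambda>t. l * t\<^sup>2 / 2 * (norm e)\<^sup>2) has_real_derivative l * t * (norm e)\<^sup>2) (at t)"
      by (auto intro!: derivative_eq_intros)
    ultimately show ?thesis
      unfolding \<psi>_def by (intro DERIV_diff)
  qed
  moreover have "gh (x + t *\<^sub>R e) \<bullet> e - gh x \<bullet> e - l * t * (norm e)\<^sup>2 \<le> 0" if "0 \<le> t" for t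
  proof -
    have "gh (x + t *\<^sub>R e) \<bullet> e - gh x \<bullet> e = (gh (x + t *\<^sub>R e) - gh x) \<bullet> e"
      by (simp add: inner_diff_left)
    also have "\<dots> \<le> norm (gh (x + t *\<^sub>R e) - gh x) * norm e"
      by (rule norm_cauchy_schwarz)
    also have "\<dots> \<le> (l * norm (t *\<^sub>R e)) * norm e"
      using lipschitz_onD[OF lip, of "x + t *\<^sub>R e" x] by (intro mult_right_mono) (auto simp: dist_norm)
    also have "\<dots> = l * t * (norm e)\<^sup>2"
      using that by (simp add: power2_eq_square)
    finally show ?thesis by simp
  qed
  ultimately have "\<exists>D. (\<psi> has_real_derivative D) (at t) \<and> D \<le> 0" if "0 \<le> t" for t
    using that by metis
  then have "\<psi> 1 \<le> \<psi> 0"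
    by (intro DERIV_nonpos_imp_nonincreasing[of 0 1 \<psi>]) simp_all
  then show ?thesis unfolding \<psi>_def by (simp add: e_def)
qed

section \<open>Weakly convex functions\<close>

lemma weakly_convex_on_imp_convex_on:
  fixes g :: "'a::euclidean_space \<Rightarrow> ereal"
  assumes wc: "weakly_convex_modulus_on D g \<beta>" and D: "convex D"
    and g: "\<And>y. g y \<noteq> -\<infinity>" "\<And>y. y \<in> D \<Longrightarrow> g y < \<infinity>"
  shows "convex_on D (\<lambda>y. real_of_ereal (g y) + \<beta> / 2 * (norm y)\<^sup>2)" (is "convex_on D ?\<psi>")
proof (rule convex_onI)
  let ?E = "{(x, r::real). g x + indicat_inf D x + ereal (\<beta> / 2 * (norm x)\<^sup>2) \<le> ereal r}"
  have conv: "convex ?E"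
    using wc unfolding weakly_convex_modulus_on_def weakly_convex_modulus_def is_arg_min_def econvex_def
    by simp
  have mem: "(x, r) \<in> ?E \<longleftrightarrow> ?\<psi> x \<le> r" if x: "x \<in> D" for x r
  proof -
    obtain a where "g x = ereal a" using g(1)[of x] g(2)[OF x] by (cases "g x") auto
    then show ?thesis using x by (simp add: indicat_inf_def)
  qed
  fix t :: real and x y
  assume t: "0 < t" "t < 1" and xy: "x \<in> D" "y \<in> D"
  have z: "(1 - t) *\<^sub>R x + t *\<^sub>R y \<in> D"
    using D t xy by (intro convexD) auto
  have "(1 - t) *\<^sub>R (x, ?\<psi> x) + t *\<^sub>R (y, ?\<psi> y) \<in> ?E"
    by (rule convexD[OF conv]) (use t xy mem in auto)
  then have "((1 - t) *\<^sub>R x + t *\<^sub>R y, (1 - t) * ?\<psi> x + t * ?\<psi> y) \<in> ?E"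
    by simp
  with mem[OF z] show "?\<psi> ((1 - t) *\<^sub>R x + t *\<^sub>R y) \<le> (1 - t) * ?\<psi> x + t * ?\<psi> y"
    by blast
qed (rule D)

text \<open>A Frechet subgradient gives a lower bound only near \<open>x\<close>. Applied at
  \<open>x + t *\<^sub>R d\<close> for small \<open>t\<close> and combined with convexity along the
  segment, it becomes, after division by \<open>t\<close>, a bound at \<open>y\<close>.\<close>

lemma weakly_convex_frechet_ineq:
  fixes g :: "'a::euclidean_space \<Rightarrow> ereal"
  assumes wc: "weakly_convex_modulus_on D g \<beta>" and D: "convex D"
    and g: "\<And>y. g y \<noteq> -\<infinity>" "\<And>y. y \<in> D \<Longrightarrow> g y < \<infinity>"
    and s: "s \<in> frechet_subdiff g x" and xy: "x \<in> D" "y \<in> D"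
  shows "real_of_ereal (g x) + s \<bullet> (y - x) - \<beta> / 2 * (norm (y - x))\<^sup>2 \<le> real_of_ereal (g y)"
proof -
  define \<psi> where "\<psi> y = real_of_ereal (g y) + \<beta> / 2 * (norm y)\<^sup>2" for y
  define p where "p = s + \<beta> *\<^sub>R x"
  have conv: "convex_on D \<psi>"
    unfolding \<psi>_def by (rule weakly_convex_on_imp_convex_on[OF wc D g])
  have \<psi>: "g y + ereal (\<beta> / 2 * (norm y)\<^sup>2) = ereal (\<psi> y)" if "y \<in> D" for y
    using g(1)[of y] g(2)[OF that] by (cases "g y") (auto simp: \<psi>_def)
  have "s + (2 * (\<beta> / 2)) *\<^sub>R (x - 0) \<in> frechet_subdiff (\<lambda>y. g y + ereal (\<beta> / 2 * (norm (y - 0))\<^sup>2)) x"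
    by (rule frechet_subdiff_add[OF s gderiv_sq_dist]) simp_all
  then have p: "p \<in> frechet_subdiff (\<lambda>y. g y + ereal (\<beta> / 2 * (norm y)\<^sup>2)) x"
    by (simp add: p_def)
  define d where "d = y - x"
  have main: "\<psi> x + p \<bullet> d - e * norm d \<le> \<psi> y" if "e > 0" for e
  proof -
    have "\<forall>\<^sub>F z in nhds x. ereal (\<psi> x) + ereal (p \<bullet> (z - x) - e * norm (z - x))
        \<le> g z + ereal (\<beta> / 2 * (norm z)\<^sup>2)"
      using frechet_subdiffD[OF p that] by (simp only: \<psi>[OF xy(1)])
    moreover have "((\<lambda>t::real. x + t *\<^sub>R d) \<longlongrightarrow> x + 0 *\<^sub>R d) (at_right 0)"
      by (intro tendsto_intros)
    ultimately have "\<forall>\<^sub>F t in at_right (0::real). ereal (\<psi> x) + ereal (p \<bullet> (x + t *\<^sub>R d - x) - e * norm (x + t *\<^sub>R d - x))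
        \<le> g (x + t *\<^sub>R d) + ereal (\<beta> / 2 * (norm (x + t *\<^sub>R d))\<^sup>2)"
      by (intro eventually_compose_filterlim[where f = "\<lambda>t::real. x + t *\<^sub>R d"]) auto
    moreover have "\<forall>\<^sub>F t in at_right (0::real). 0 < t \<and> t < 1"
      using eventually_at_right_real[of 0 1] by simp
    ultimately have "\<forall>\<^sub>F t in at_right (0::real). \<psi> x + p \<bullet> d - e * norm d \<le> \<psi> y"
    proof eventually_elim
      case (elim t)
      have z: "x + t *\<^sub>R d = (1 - t) *\<^sub>R x + t *\<^sub>R y"
        by (simp add: d_def algebra_simps)
      have "x + t *\<^sub>R d \<in> D"
        unfolding z using D elim xy by (intro convexD) auto
      from elim(1)[unfolded \<psi>[OF this]]
      have "\<psi> x + t * (p \<bullet> d - e * norm d) \<le> \<psi> (x + t *\<^sub>R d)"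
        using elim(2) by (simp add: algebra_simps)
      also have "\<dots> \<le> (1 - t) * \<psi> x + t * \<psi> y"
        unfolding z using elim xy by (intro convex_onD[OF conv]) auto
      finally have "t * (\<psi> x + p \<bullet> d - e * norm d) \<le> t * \<psi> y"
        by (simp add: algebra_simps)
      then show ?case using elim(2) by simp
    qed
    then show ?thesis by simp
  qed
  have "\<psi> x + p \<bullet> d \<le> \<psi> y"
  proof (rule field_le_epsilon)
    fix e :: real assume "e > 0"
    \<comment> \<open>The denominator \<open>norm d + 1\<close> also covers the case
      \<open>d = 0\<close>.\<close>
    have "norm d / (norm d + 1) \<le> 1"
      by (rule divide_le_eq_1_pos[THEN iffD2]) (auto intro: add_nonneg_pos)
    then have "e / (norm d + 1) * norm d \<le> e"
      using \<open>e > 0\<close> mult_left_mono[of "norm d / (norm d + 1)" 1 e] by simp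
    moreover have "e / (norm d + 1) > 0"
      using \<open>e > 0\<close> by (intro divide_pos_pos) (auto intro: add_nonneg_pos)
    ultimately show "\<psi> x + p \<bullet> d \<le> \<psi> y + e"
      using main[of "e / (norm d + 1)"] by linarith
  qed
  \<comment> \<open>Expanded around \<open>x\<close>, the added quadratic leaves
    \<open>\<beta> / 2 * (norm d)\<^sup>2\<close> and a linear term that cancels the shift
    \<open>\<beta> *\<^sub>R x\<close> contained in \<open>p\<close>.\<close>
  moreover have "(norm y)\<^sup>2 = (norm x)\<^sup>2 + 2 * (x \<bullet> d) + (norm d)\<^sup>2"
    unfolding d_def power2_norm_eq_inner by (simp add: inner_diff_left inner_diff_right inner_commute)
  then have "\<beta> / 2 * (norm y)\<^sup>2 = \<beta> / 2 * (norm x)\<^sup>2 + \<beta> * (x \<bullet> d) + \<beta> / 2 * (norm d)\<^sup>2"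
    by (simp only:) (simp add: algebra_simps)
  ultimately show ?thesis
    unfolding \<psi>_def p_def d_def[symmetric] inner_add_left inner_scaleR_left by linarith
qed

text \<open>Every term of the Frechet inequality passes to the limit: convergence of the values is
  part of the limiting subdifferential, and openness of \<open>D\<close> places the approximating
  points in \<open>D\<close>.\<close>

lemma weakly_convex_limiting_ineq:
  fixes g :: "'a::euclidean_space \<Rightarrow> ereal"
  assumes wc: "weakly_convex_modulus_on D g \<beta>" and D: "convex D" "open D"
    and g: "\<And>y. g y \<noteq> -\<infinity>" "\<And>y. y \<in> D \<Longrightarrow> g y < \<infinity>"
    and s: "s \<in> limiting_subdiff g x" and xy: "x \<in> D" "y \<in> D"
  shows "real_of_ereal (g x) + s \<bullet> (y - x) - \<beta> / 2 * (norm (y - x))\<^sup>2 \<le> real_of_ereal (g y)"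
proof -
  obtain X S where X: "X \<longlonglongrightarrow> x" "(\<lambda>n. g (X n)) \<longlonglongrightarrow> g x" "\<And>n. S n \<in> frechet_subdiff g (X n)" "S \<longlonglongrightarrow> s"
    using s unfolding limiting_subdiff_def by blast
  have "g x = ereal (real_of_ereal (g x))"
    using g(1)[of x] g(2)[OF xy(1)] by (cases "g x") auto
  then have gX: "(\<lambda>n. real_of_ereal (g (X n))) \<longlonglongrightarrow> real_of_ereal (g x)"
    using X(2) by (metis lim_real_of_ereal)
  have "\<forall>\<^sub>F n in sequentially. X n \<in> D"
    using X(1) D(2) xy(1) by (rule topological_tendstoD)
  then have "\<forall>\<^sub>F n in sequentially. real_of_ereal (g (X n)) + S n \<bullet> (y - X n) - \<beta> / 2 * (norm (y - X n))\<^sup>2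
      \<le> real_of_ereal (g y)"
    by eventually_elim (rule weakly_convex_frechet_ineq[OF wc D(1) g X(3) _ xy(2)])
  moreover have "(\<lambda>n. real_of_ereal (g (X n)) + S n \<bullet> (y - X n) - \<beta> / 2 * (norm (y - X n))\<^sup>2)
      \<longlonglongrightarrow> real_of_ereal (g x) + s \<bullet> (y - x) - \<beta> / 2 * (norm (y - x))\<^sup>2"
    by (intro tendsto_intros gX X)
  ultimately show ?thesis
    by (intro tendsto_upperbound[of _ _ sequentially]) auto
qed

text \<open>By the subgradient inequality \<open>k\<close> is minimal at \<open>x\<close> over the
  open set \<open>D\<close>, so its derivative vanishes; in the direction \<open>v - s\<close> it
  equals the squared norm of that vector.\<close>

lemma weakly_convex_limiting_gderiv:
  fixes g :: "'a::euclidean_space \<Rightarrow> ereal"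
  assumes wc: "weakly_convex_modulus_on D g \<beta>" and D: "convex D" "open D"
    and g: "\<And>y. g y \<noteq> -\<infinity>" "\<And>y. y \<in> D \<Longrightarrow> g y < \<infinity>"
    and s: "s \<in> limiting_subdiff g x" and x: "x \<in> D"
    and deriv: "GDERIV (\<lambda>w. real_of_ereal (g w)) x :> v"
  shows "s = v"
proof -
  define k where "k y = real_of_ereal (g y) - s \<bullet> y + \<beta> / 2 * ((y - x) \<bullet> (y - x))" for y
  have "(k has_derivative (\<lambda>h. h \<bullet> v - s \<bullet> h + \<beta> / 2 * ((x - x) \<bullet> (h - 0) + (h - 0) \<bullet> (x - x)))) (at x)"
    unfolding k_def using deriv unfolding gderiv_def by (intro derivative_intros)
  then have dk: "(k has_derivative (\<lambda>h. h \<bullet> v - s \<bullet> h)) (at x)" by simp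
  have "k x \<le> k y" if "y \<in> D" for y
    using weakly_convex_limiting_ineq[OF wc D g s x that]
    by (simp add: k_def power2_norm_eq_inner inner_diff_right)
  then have "(\<lambda>h. h \<bullet> v - s \<bullet> h) = (\<lambda>h. 0)"
    using differential_zero_maxmin[OF x D(2) dk] by blast
  then have "(v - s) \<bullet> v - s \<bullet> (v - s) = 0"
    by (rule fun_cong)
  then have "(v - s) \<bullet> (v - s) = 0"
    by (simp add: inner_diff_left inner_diff_right inner_commute)
  then show ?thesis by simp
qed

section \<open>The algorithm\<close>

lemma norm_adjoint_le:
  fixes A :: "'a::euclidean_space \<Rightarrow> 'b::euclidean_space"
  assumes "linear A"
  shows "norm (adjoint A y) \<le> onorm A * norm y"
proof (cases "adjoint A y = 0")
  case True
  then show ?thesis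
    using assms by (simp add: onorm_pos_le linear_conv_bounded_linear)
next
  case False
  have bl: "bounded_linear A" using assms by (simp add: linear_conv_bounded_linear)
  have "norm (adjoint A y) * norm (adjoint A y) = adjoint A y \<bullet> adjoint A y"
    by (simp add: dot_square_norm power2_eq_square)
  also have "\<dots> = A (adjoint A y) \<bullet> y"
    by (rule adjoint_works[OF assms])
  also have "\<dots> \<le> norm (A (adjoint A y)) * norm y"
    by (rule norm_cauchy_schwarz)
  also have "\<dots> \<le> (onorm A * norm (adjoint A y)) * norm y"
    by (intro mult_right_mono onorm[OF bl]) simp
  finally have "norm (adjoint A y) * norm (adjoint A y) \<le> norm (adjoint A y) * (onorm A * norm y)"
    by (simp add: mult_ac)
  then show ?thesis using False by simp
qed

lemma mult_le_half_squares: "(a::real) * b \<le> (a\<^sup>2 + b\<^sup>2) / 2"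
  using sum_squares_bound[of a b] by simp

locale prox_subgrad =
  fixes C D U :: "'a::euclidean_space set"
    and A :: "'a \<Rightarrow> 'b::euclidean_space"
    and f g :: "'a \<Rightarrow> ereal"
    and h :: "'b \<Rightarrow> real"
    and grad_h :: "'b \<Rightarrow> 'b"
    and grad_g :: "'a \<Rightarrow> 'a"
    and l l_g \<beta> \<delta> lam_bar mu_bar tau_bar :: real
    and \<tau> lam \<mu> :: "nat \<Rightarrow> real"
    and gs x :: "nat \<Rightarrow> 'a"
  assumes C: "closed C"
    and A: "linear A"
    and f: "eproper f" "lsc f"
    and h: "\<And>y. GDERIV h y :> grad_h y" "l-lipschitz_on UNIV grad_h"
    and g: "\<And>y. g y \<noteq> -\<infinity>"
    and D: "open D" "convex D" "C \<subseteq> D"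
    and g_on_D: "\<And>y. y \<in> D \<Longrightarrow> g y < \<infinity>" "continuous_on D g" "weakly_convex_modulus_on D g \<beta>"
    and params: "0 \<le> lam_bar" "0 \<le> mu_bar" "0 < \<delta>"
    and alg: "prox_subgrad_extrap C A f grad_h l g \<beta> lam_bar mu_bar \<delta> \<tau> lam \<mu> gs x"
    and bounded_below: "\<exists>m::real. \<forall>y\<in>C. ereal m \<le> objective f h A g y"
    and bounded_C0: "bounded {y \<in> C. objective f h A g y \<le> objective f h A g (x 0)}"
    and U: "open U" "C \<inter> edom f \<subseteq> U"
    and g_on_U: "\<And>y. y \<in> U \<Longrightarrow> g y < \<infinity>"
      "\<And>y. y \<in> U \<Longrightarrow> GDERIV (\<lambda>w. real_of_ereal (g w)) y :> grad_g y"
      "l_g-lipschitz_on (C \<inter> edom f) grad_g"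
    and tau_liminf: "liminf (\<lambda>n. ereal (\<tau> n)) = ereal tau_bar" "0 < tau_bar"
begin

abbreviation "F \<equiv> objective f h A g"

text \<open>Extrapolation enters the descent estimate through products of \<open>\<Delta> n\<close>
  and \<open>d_prev n\<close>, with factor \<open>l * (onorm A)\<^sup>2 * lam_bar\<close> from
  \<open>u\<close> and \<open>mu_bar\<close> from \<open>v\<close>. Splitting the products into half
  sums of squares puts the weight \<open>c\<close> on each square.\<close>

definition c :: real where "c = 1 / 2 * (l * (onorm A)\<^sup>2 * lam_bar + mu_bar)"

text \<open>Meaningful only on \<open>C \<inter> edom f\<close>, because \<^const>\<open>real_of_ereal\<close> sends \<open>\<infinity>\<close> to \<open>0\<close>.\<close>

definition Fr :: "'a \<Rightarrow> real" where
  "Fr y = real_of_ereal (f y) + h (A y) - real_of_ereal (g y)"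

definition \<Delta> :: "nat \<Rightarrow> 'a" where "\<Delta> n = x (Suc n) - x n"

text \<open>Vanishes at \<open>n = 0\<close> by truncated subtraction, as the convention for the
  iterate before \<open>x 0\<close> demands.\<close>

definition d_prev :: "nat \<Rightarrow> 'a" where "d_prev n = x n - x (n - 1)"

definition u :: "nat \<Rightarrow> 'a" where "u n = x n + lam n *\<^sub>R d_prev n"

definition v :: "nat \<Rightarrow> 'a" where "v n = x n + \<mu> n *\<^sub>R d_prev n"

definition w :: "nat \<Rightarrow> 'a" where "w n = adjoint A (grad_h (A (u n)))"

lemma d_prev_Suc [simp]: "d_prev (Suc n) = \<Delta> n"
  by (simp add: d_prev_def \<Delta>_def)

lemma bounded_linear_A: "bounded_linear A"
  using A by (simp add: linear_conv_bounded_linear)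

lemma onorm_A_nonneg: "0 \<le> onorm A"
  by (rule onorm_pos_le[OF bounded_linear_A])

lemma norm_A_le: "norm (A y) \<le> onorm A * norm y"
  by (rule onorm[OF bounded_linear_A])

lemma l_nonneg: "0 \<le> l"
  using h(2) by (rule lipschitz_on_nonneg)

lemma \<beta>_nonneg: "0 \<le> \<beta>"
  using g_on_D(3)
  by (simp add: weakly_convex_modulus_on_def weakly_convex_modulus_def is_arg_min_def)

lemma c_nonneg: "0 \<le> c"
  using l_nonneg params by (simp add: c_def)

lemma f_finite:
  assumes "y \<in> edom f" shows "f y = ereal (real_of_ereal (f y))"
  using assms f(1) by (cases "f y") (auto simp: edom_def eproper_def)

lemma g_finite:
  assumes "y \<in> C" shows "g y = ereal (real_of_ereal (g y))"
proof -
  have "g y < \<infinity>" using assms D(3) g_on_D(1) by blast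
  then show ?thesis using g[of y] by (cases "g y") auto
qed

lemma F_finite:
  assumes "y \<in> C \<inter> edom f" shows "F y = ereal (Fr y)"
proof -
  have "f y = ereal (real_of_ereal (f y))" "g y = ereal (real_of_ereal (g y))"
    using assms f_finite g_finite by blast+
  then obtain a b where "f y = ereal a" "g y = ereal b" by blast
  then show ?thesis by (simp add: objective_def Fr_def)
qed

lemma F_infinite:
  assumes "y \<in> C" "y \<notin> edom f" shows "F y = \<infinity>"
proof -
  obtain b where "g y = ereal b" using g_finite assms by blast
  then show ?thesis using assms by (simp add: objective_def edom_def)
qed

lemma alg_step:
  "0 < \<tau> n" "\<tau> n \<le> 1 / (\<beta> + 2 * \<delta> + l * (onorm A)\<^sup>2 * (2 * lam_bar + 1) + 2 * mu_bar)"
  "0 \<le> lam n" "lam n \<le> lam_bar" "0 \<le> \<mu> n" "\<mu> n \<le> mu_bar * \<tau> n" "gs n \<in> limiting_subdiff g (x n)"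
  "x (Suc n) \<in> argmin_on C (\<lambda>y. f y + ereal (1 / (2 * \<tau> n) *
     (norm (y - v n + \<tau> n *\<^sub>R w n - \<tau> n *\<^sub>R gs n))\<^sup>2))"
  using alg unfolding prox_subgrad_extrap_def Let_def u_def v_def w_def d_prev_def by blast+

lemma x_in_C: "x n \<in> C"
proof (cases n)
  case 0
  then show ?thesis using alg by (simp add: prox_subgrad_extrap_def)
next
  case (Suc m)
  then show ?thesis using alg_step(8)[of m] by (simp add: argmin_on_def)
qed

lemma x_Suc_in: "x (Suc n) \<in> C \<inter> edom f"
proof -
  have "f (x (Suc n)) + ereal (1 / (2 * \<tau> n) * (norm (x (Suc n) - v n + \<tau> n *\<^sub>R w n - \<tau> n *\<^sub>R gs n))\<^sup>2) < \<infinity>"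
    using alg_step(8)[of n] unfolding argmin_on_def by blast
  then show ?thesis using x_in_C[of "Suc n"] by (simp add: edom_def)
qed

section \<open>Energy descent\<close>

lemma optimality:
  assumes "y \<in> C \<inter> edom f"
  shows "real_of_ereal (f (x (Suc n))) \<le> real_of_ereal (f y) + (w n - gs n) \<bullet> (y - x (Suc n))
    + 1 / (2 * \<tau> n) * ((norm (y - v n))\<^sup>2 - (norm (x (Suc n) - v n))\<^sup>2)"
proof -
  define q t where "q = w n - gs n" and "t = \<tau> n"
  have t: "0 < t" using alg_step(1) by (simp add: t_def)
  \<comment> \<open>Expanding around \<open>v n\<close> isolates a multiple of
    \<open>(norm q)\<^sup>2\<close> that does not depend on \<open>z\<close> and cancels in the
    comparison of two points.\<close>
  have ex: "1 / (2 * t) * (norm (z - v n + \<tau> n *\<^sub>R w n - \<tau> n *\<^sub>R gs n))\<^sup>2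
     = 1 / (2 * t) * (norm (z - v n))\<^sup>2 + q \<bullet> (z - v n) + t / 2 * (norm q)\<^sup>2" for z
  proof -
    have "z - v n + \<tau> n *\<^sub>R w n - \<tau> n *\<^sub>R gs n = (z - v n) + t *\<^sub>R q"
      by (simp add: q_def t_def scaleR_diff_right)
    moreover have "(norm ((z - v n) + t *\<^sub>R q))\<^sup>2 = (norm (z - v n))\<^sup>2 + 2 * t * (q \<bullet> (z - v n)) + t\<^sup>2 * (norm q)\<^sup>2"
      unfolding power2_norm_eq_inner
      by (simp add: inner_add_left inner_add_right inner_commute power2_eq_square)
    ultimately show ?thesis using t by (simp add: field_simps power2_eq_square)
  qed
  have "f (x (Suc n)) + ereal (1 / (2 * \<tau> n) * (norm (x (Suc n) - v n + \<tau> n *\<^sub>R w n - \<tau> n *\<^sub>R gs n))\<^sup>2)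
     \<le> f y + ereal (1 / (2 * \<tau> n) * (norm (y - v n + \<tau> n *\<^sub>R w n - \<tau> n *\<^sub>R gs n))\<^sup>2)"
    using alg_step(8)[of n] assms unfolding argmin_on_def by blast
  moreover obtain a b where ab: "f (x (Suc n)) = ereal a" "f y = ereal b"
    using f_finite x_Suc_in[of n] assms by blast
  ultimately have "a + 1 / (2 * t) * (norm (x (Suc n) - v n + \<tau> n *\<^sub>R w n - \<tau> n *\<^sub>R gs n))\<^sup>2
     \<le> b + 1 / (2 * t) * (norm (y - v n + \<tau> n *\<^sub>R w n - \<tau> n *\<^sub>R gs n))\<^sup>2"
    by (simp add: t_def)
  then have "a + 1 / (2 * t) * (norm (x (Suc n) - v n))\<^sup>2 + q \<bullet> (x (Suc n) - v n)
     \<le> b + 1 / (2 * t) * (norm (y - v n))\<^sup>2 + q \<bullet> (y - v n)"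
    unfolding ex by simp
  moreover have "q \<bullet> (y - v n) - q \<bullet> (x (Suc n) - v n) = q \<bullet> (y - x (Suc n))"
    by (simp add: inner_diff_right)
  ultimately have "a \<le> b + q \<bullet> (y - x (Suc n)) + (1 / (2 * t) * (norm (y - v n))\<^sup>2 - 1 / (2 * t) * (norm (x (Suc n) - v n))\<^sup>2)"
    by linarith
  then show ?thesis unfolding right_diff_distrib ab q_def t_def by simp
qed

text \<open>The comparison with \<open>x n\<close> needs \<open>f (x n)\<close> finite, which can
  fail only at \<open>n = 0\<close>.\<close>

lemma prox_descent:
  assumes "x n \<in> edom f"
  shows "Fr (x (Suc n)) + (c + \<delta>) * (norm (\<Delta> n))\<^sup>2 \<le> Fr (x n) + c * (norm (d_prev n))\<^sup>2"
proof -
  define N1 N2 where "N1 = (norm (\<Delta> n))\<^sup>2" and "N2 = (norm (d_prev n))\<^sup>2"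
  have N: "0 \<le> N1" "0 \<le> N2" by (simp_all add: N1_def N2_def)
  have x: "x (Suc n) = x n + \<Delta> n" by (simp add: \<Delta>_def)
  define B where "B = \<beta> + 2 * \<delta> + l * (onorm A)\<^sup>2 * (2 * lam_bar + 1) + 2 * mu_bar"
  have "0 \<le> l * (onorm A)\<^sup>2 * (2 * lam_bar + 1)" using l_nonneg params by simp
  then have B: "0 < B" using \<beta>_nonneg params by (simp add: B_def)
  have "B \<le> 1 / \<tau> n"
    using alg_step(1,2)[of n] B unfolding B_def[symmetric] by (simp add: field_simps)
  then have \<tau>1: "B / 2 * N1 \<le> 1 / (2 * \<tau> n) * N1"
    using N by (intro mult_right_mono) auto
  have sq: "(norm (x n - v n))\<^sup>2 - (norm (x (Suc n) - v n))\<^sup>2 = - N1 + 2 * \<mu> n * (\<Delta> n \<bullet> d_prev n)"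
    unfolding x v_def N1_def power2_norm_eq_inner
    by (simp add: inner_add_left inner_add_right inner_diff_left inner_diff_right inner_commute)
  have cs: "\<Delta> n \<bullet> d_prev n \<le> (N1 + N2) / 2"
    using order_trans[OF norm_cauchy_schwarz mult_le_half_squares] by (simp add: N1_def N2_def)
  have \<mu>1: "\<mu> n / \<tau> n * (\<Delta> n \<bullet> d_prev n) \<le> mu_bar / 2 * (N1 + N2)"
  proof -
    have "\<mu> n / \<tau> n * (\<Delta> n \<bullet> d_prev n) \<le> \<mu> n / \<tau> n * ((N1 + N2) / 2)"
      using cs alg_step[of n] by (intro mult_left_mono) auto
    also have "\<dots> \<le> mu_bar * ((N1 + N2) / 2)"
      using alg_step[of n] N by (intro mult_right_mono) (auto simp: field_simps)
    finally show ?thesis by simp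
  qed
  have "real_of_ereal (f (x (Suc n))) \<le> real_of_ereal (f (x n)) + (w n - gs n) \<bullet> (x n - x (Suc n))
    + 1 / (2 * \<tau> n) * (- N1 + 2 * \<mu> n * (\<Delta> n \<bullet> d_prev n))"
    using optimality[of "x n" n] assms x_in_C[of n] unfolding sq by simp
  also have "1 / (2 * \<tau> n) * (- N1 + 2 * \<mu> n * (\<Delta> n \<bullet> d_prev n))
     = - (1 / (2 * \<tau> n) * N1) + \<mu> n / \<tau> n * (\<Delta> n \<bullet> d_prev n)"
    using alg_step(1)[of n] by (simp add: field_simps)
  also have "(w n - gs n) \<bullet> (x n - x (Suc n)) = gs n \<bullet> \<Delta> n - w n \<bullet> \<Delta> n"
    unfolding x by (simp add: inner_diff_left)
  finally have F1: "real_of_ereal (f (x (Suc n))) \<le> real_of_ereal (f (x n)) + (gs n \<bullet> \<Delta> n - w n \<bullet> \<Delta> n)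
    - B / 2 * N1 + mu_bar / 2 * (N1 + N2)"
    using \<tau>1 \<mu>1 by linarith
  have G1: "real_of_ereal (g (x n)) + gs n \<bullet> \<Delta> n - \<beta> / 2 * N1 \<le> real_of_ereal (g (x (Suc n)))"
    using weakly_convex_limiting_ineq[OF g_on_D(3) D(2,1) g g_on_D(1) alg_step(7)[of n]]
      x_in_C[of n] x_in_C[of "Suc n"] D(3) unfolding \<Delta>_def N1_def by blast
  have Ad: "A (x (Suc n)) - A (x n) = A (\<Delta> n)" "A (x n) - A (u n) = - (lam n *\<^sub>R A (d_prev n))"
    unfolding \<Delta>_def u_def by (simp_all add: linear_diff[OF A] linear_add[OF A] linear_scale[OF A])
  have An: "(norm (A (\<Delta> n)))\<^sup>2 \<le> (onorm A)\<^sup>2 * N1"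
    using power_mono[OF norm_A_le[of "\<Delta> n"], of 2] by (simp add: N1_def power_mult_distrib)
  have "h (A (x (Suc n))) \<le> h (A (x n)) + grad_h (A (x n)) \<bullet> A (\<Delta> n) + l / 2 * (norm (A (\<Delta> n)))\<^sup>2"
    using descent_lemma[OF h, of "A (x (Suc n))" "A (x n)"] unfolding Ad .
  also have "grad_h (A (x n)) \<bullet> A (\<Delta> n)
      = w n \<bullet> \<Delta> n + (grad_h (A (x n)) - grad_h (A (u n))) \<bullet> A (\<Delta> n)"
  proof -
    have "w n \<bullet> \<Delta> n = grad_h (A (u n)) \<bullet> A (\<Delta> n)"
      unfolding w_def using adjoint_works[OF A, of "\<Delta> n" "grad_h (A (u n))"] by (simp add: inner_commute)
    then show ?thesis by (simp add: inner_diff_left)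
  qed
  \<comment> \<open>The price of evaluating the gradient at \<open>u n\<close> instead of
    \<open>x n\<close>: the Lipschitz bound produces a product of consecutive steps.\<close>
  also have "(grad_h (A (x n)) - grad_h (A (u n))) \<bullet> A (\<Delta> n)
      \<le> l * (onorm A)\<^sup>2 * lam_bar / 2 * (N1 + N2)"
  proof -
    have "(grad_h (A (x n)) - grad_h (A (u n))) \<bullet> A (\<Delta> n)
      \<le> norm (grad_h (A (x n)) - grad_h (A (u n))) * norm (A (\<Delta> n))"
      by (rule norm_cauchy_schwarz)
    also have "\<dots> \<le> (l * (lam n * (onorm A * norm (d_prev n)))) * (onorm A * norm (\<Delta> n))"
    proof (rule mult_mono)
      have "norm (grad_h (A (x n)) - grad_h (A (u n))) \<le> l * norm (A (x n) - A (u n))"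
        using lipschitz_onD[OF h(2), of "A (x n)" "A (u n)"] by (simp add: dist_norm)
      also have "\<dots> \<le> l * (lam n * (onorm A * norm (d_prev n)))"
        unfolding Ad using l_nonneg alg_step(3)[of n] norm_A_le[of "d_prev n"]
        by (simp add: mult_left_mono)
      finally show "norm (grad_h (A (x n)) - grad_h (A (u n))) \<le> l * (lam n * (onorm A * norm (d_prev n)))" .
    qed (use norm_A_le l_nonneg alg_step(3)[of n] onorm_A_nonneg in auto)
    also have "\<dots> = (l * (onorm A)\<^sup>2) * (lam n * (norm (\<Delta> n) * norm (d_prev n)))"
      by (simp add: power2_eq_square)
    also have "\<dots> \<le> (l * (onorm A)\<^sup>2) * (lam_bar * ((N1 + N2) / 2))"
      using l_nonneg alg_step(3,4)[of n] params mult_le_half_squares[of "norm (\<Delta> n)" "norm (d_prev n)"]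
      by (intro mult_left_mono[OF mult_mono]) (auto simp: N1_def N2_def)
    finally show ?thesis by (simp add: algebra_simps)
  qed
  also have "l / 2 * (norm (A (\<Delta> n)))\<^sup>2 \<le> l / 2 * ((onorm A)\<^sup>2 * N1)"
    using An l_nonneg by (intro mult_left_mono) auto
  finally have H1: "h (A (x (Suc n))) \<le> h (A (x n)) + (w n \<bullet> \<Delta> n + l * (onorm A)\<^sup>2 * lam_bar / 2 * (N1 + N2))
     + l / 2 * ((onorm A)\<^sup>2 * N1)"
    by simp
  \<comment> \<open>\<open>B / 2\<close> equals
    \<open>\<beta> / 2 + l * (onorm A)\<^sup>2 / 2 + \<delta> + 2 * c\<close>. It pays for the
    curvature of \<open>g\<close> and \<open>h\<close> and for the share \<open>c\<close> of the
    cross terms, and leaves \<open>c + \<delta>\<close> on \<open>N1\<close>.\<close>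
  have "- B / 2 * N1 + mu_bar / 2 * (N1 + N2) + \<beta> / 2 * N1 + l * (onorm A)\<^sup>2 * lam_bar / 2 * (N1 + N2)
     + l / 2 * ((onorm A)\<^sup>2 * N1) = c * N2 - (c + \<delta>) * N1"
    by (simp add: B_def c_def field_simps)
  with F1 G1 H1 show ?thesis
    unfolding Fr_def N1_def[symmetric] N2_def[symmetric] by linarith
qed

text \<open>The gradient of \<open>g\<close> need not be continuous on \<open>U\<close>, so that limiting subgradients are
  gradients is a consequence of weak convexity here.\<close>

lemma gs_eq_grad:
  assumes "x n \<in> edom f"
  shows "gs n = grad_g (x n)"
  using assms x_in_C[of n] U(2) D(3)
  by (intro weakly_convex_limiting_gderiv[OF g_on_D(3) D(2,1) g g_on_D(1) alg_step(7) _ g_on_U(2)]) auto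

text \<open>The value of \<open>G\<close> at \<open>(x (Suc n), x n)\<close> as a real
  number.\<close>

definition H :: "nat \<Rightarrow> real" where "H n = Fr (x (Suc n)) + c * (norm (\<Delta> n))\<^sup>2"

lemma H_descent: "H (Suc n) + \<delta> * (norm (\<Delta> (Suc n)))\<^sup>2 \<le> H n"
  using prox_descent[of "Suc n"] x_Suc_in[of n] by (simp add: H_def algebra_simps)

lemma H_decseq: "decseq H"
proof (rule decseq_SucI)
  fix n
  have "0 \<le> \<delta> * (norm (\<Delta> (Suc n)))\<^sup>2" using params by simp
  then show "H (Suc n) \<le> H n" using H_descent[of n] by linarith
qed

lemma Fr_le_H: "Fr (x (Suc n)) \<le> H n"
  using c_nonneg by (simp add: H_def)

lemma bounded_iterates: "bounded (range (\<lambda>n. x (Suc n)))"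
proof (rule bounded_subset[OF bounded_C0], rule image_subsetI)
  fix n
  have "F (x (Suc n)) \<le> F (x 0)"
  proof (cases "x 0 \<in> edom f")
    case True
    have "H 0 \<le> Fr (x 0)"
    proof -
      have "0 \<le> \<delta> * (norm (\<Delta> 0))\<^sup>2" using params by simp
      then show ?thesis using prox_descent[OF True] by (simp add: H_def d_prev_def algebra_simps)
    qed
    moreover have "H n \<le> H 0" using H_decseq by (simp add: decseqD)
    ultimately have "Fr (x (Suc n)) \<le> Fr (x 0)" using Fr_le_H[of n] by linarith
    then show ?thesis using F_finite x_Suc_in True x_in_C by simp
  next
    \<comment> \<open>Then \<open>F (x 0) = \<infinity>\<close>, and the sublevel set is all of
      \<open>C\<close>.\<close>
    case False
    then show ?thesis using F_infinite x_in_C by simp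
  qed
  then show "x (Suc n) \<in> {y \<in> C. F y \<le> F (x 0)}" using x_in_C by simp
qed

lemma H_convergent: "\<exists>L. H \<longlonglongrightarrow> L"
proof -
  obtain m :: real where m: "\<And>y. y \<in> C \<Longrightarrow> ereal m \<le> F y" using bounded_below by blast
  have "m \<le> H n" for n
    using m[OF x_in_C[of "Suc n"]] F_finite[OF x_Suc_in[of n]] Fr_le_H[of n] by simp
  then show ?thesis using decseq_convergent[OF H_decseq] by metis
qed

lemma \<Delta>_tendsto: "\<Delta> \<longlonglongrightarrow> 0"
proof -
  obtain L where L: "H \<longlonglongrightarrow> L" using H_convergent by blast
  have "(\<lambda>n. (norm (\<Delta> (Suc n)))\<^sup>2) \<longlonglongrightarrow> 0"
  proof (rule tendsto_sandwich[OF _ _ tendsto_const])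
    have "(\<lambda>n. (H n - H (Suc n)) / \<delta>) \<longlonglongrightarrow> (L - L) / \<delta>"
      using params by (intro tendsto_intros L LIMSEQ_Suc) auto
    then show "(\<lambda>n. (H n - H (Suc n)) / \<delta>) \<longlonglongrightarrow> 0" by simp
    show "\<forall>\<^sub>F n in sequentially. (norm (\<Delta> (Suc n)))\<^sup>2 \<le> (H n - H (Suc n)) / \<delta>"
      using H_descent params by (intro always_eventually allI) (simp add: field_simps)
  qed simp
  then have "(\<lambda>n. \<Delta> (Suc n)) \<longlonglongrightarrow> 0"
    by (simp add: tendsto_norm_zero_iff)
  then show ?thesis by (rule LIMSEQ_imp_Suc)
qed

section \<open>Energy limit at a cluster point\<close>

lemma \<tau>_lower_bound: "\<exists>t0>0. \<forall>n. t0 \<le> \<tau> n"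
proof -
  have "ereal (tau_bar / 2) < liminf (\<lambda>n. ereal (\<tau> n))" using tau_liminf by simp
  then have "\<forall>\<^sub>F n in sequentially. ereal (tau_bar / 2) < ereal (\<tau> n)"
    using le_Liminf_iff[of "liminf (\<lambda>n. ereal (\<tau> n))" sequentially "\<lambda>n. ereal (\<tau> n)"] by blast
  then obtain N where N: "\<And>n. n \<ge> N \<Longrightarrow> tau_bar / 2 < \<tau> n"
    by (auto simp: eventually_sequentially)
  let ?S = "insert (tau_bar / 2) (\<tau> ` {..<N})"
  have "0 < Min ?S" using tau_liminf(2) alg_step(1) by (subst Min_gr_iff) auto
  moreover have "Min ?S \<le> \<tau> n" for n
  proof (cases "n < N")
    case True
    then show ?thesis by (intro Min_le) auto
  next
    case False
    have "Min ?S \<le> tau_bar / 2" by (rule Min_le) simp_all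
    with N[of n] False show ?thesis by simp
  qed
  ultimately show ?thesis by blast
qed

lemma isCont_gr:
  assumes "y \<in> C"
  shows "isCont (\<lambda>z. real_of_ereal (g z)) y"
proof -
  have y: "y \<in> D" using assms D(3) by blast
  have "isCont g y" using g_on_D(2) D(1) y by (simp add: continuous_on_eq_continuous_at)
  then have "(g \<longlongrightarrow> ereal (real_of_ereal (g y))) (at y)"
    using g_finite[OF assms] by (simp add: isCont_def)
  then show ?thesis unfolding isCont_def by (rule lim_real_of_ereal)
qed

lemma isCont_hA: "isCont (\<lambda>z. h (A z)) y"
proof -
  have "isCont h (A y)"
    using h(1)[of "A y"] unfolding gderiv_def by (rule has_derivative_continuous)
  moreover have "isCont A y"
    using bounded_linear_A by (simp add: linear_continuous_at)
  ultimately show ?thesis by (rule isCont_o2[rotated])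
qed

lemma lsc_eventually:
  assumes "ereal M < f y" "X \<longlonglongrightarrow> y"
  shows "\<forall>\<^sub>F n in sequentially. ereal M < f (X n)"
proof -
  have "ereal M < Liminf (at y) f" using assms(1) f(2) unfolding lsc_def by (meson less_le_trans)
  then have "\<forall>\<^sub>F z in at y. ereal M < f z"
    using le_Liminf_iff[of "Liminf (at y) f" "at y" f] by blast
  \<comment> \<open>\<open>Liminf (at y)\<close> ignores \<open>y\<close> itself; the assumed strict
    bound at \<open>y\<close> fills in the missing point.\<close>
  then have "\<forall>\<^sub>F z in nhds y. ereal M < f z"
    using assms(1) by (simp add: eventually_nhds_conv_at)
  then show ?thesis using assms(2) by (rule eventually_compose_filterlim)
qed

text \<open>The terms with \<open>g\<close> and \<open>h\<close> are continuous. For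
  \<open>f\<close>, lower semicontinuity gives one half of the limit; the other half comes from
  \<open>optimality\<close> with the cluster point as competitor, whose additional terms
  vanish.\<close>

lemma cluster_point:
  "\<exists>xs r. strict_mono (r :: nat \<Rightarrow> nat) \<and> (\<lambda>k. x (Suc (r k))) \<longlonglongrightarrow> xs \<and> xs \<in> C \<inter> edom f \<and> H \<longlonglongrightarrow> Fr xs"
proof -
  obtain L where L: "H \<longlonglongrightarrow> L" using H_convergent by blast
  obtain xs r where r: "strict_mono (r :: nat \<Rightarrow> nat)" "((\<lambda>n. x (Suc n)) \<circ> r) \<longlonglongrightarrow> xs"
    using bounded_imp_convergent_subsequence[OF bounded_iterates] by blast
  define X where "X k = x (Suc (r k))" for k
  have X: "X \<longlonglongrightarrow> xs" using r(2) by (simp add: X_def[abs_def] o_def)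
  have r_top: "filterlim r at_top sequentially" using r(1) by (rule filterlim_subseq)
  have C_xs: "xs \<in> C"
    using closed_sequentially[OF C _ X] x_in_C by (simp add: X_def)
  have gX: "(\<lambda>k. real_of_ereal (g (X k))) \<longlonglongrightarrow> real_of_ereal (g xs)"
    using isCont_gr[OF C_xs] X by (rule isCont_tendsto_compose)
  have hX: "(\<lambda>k. h (A (X k))) \<longlonglongrightarrow> h (A xs)"
    using isCont_hA X by (rule isCont_tendsto_compose)
  have fX: "f (X k) = ereal (real_of_ereal (f (X k)))" for k
    using f_finite x_Suc_in[of "r k"] by (simp add: X_def)
  have dom_xs: "xs \<in> edom f"
  proof (rule ccontr)
    assume "xs \<notin> edom f"
    then have "f xs = \<infinity>" by (simp add: edom_def)
    \<comment> \<open>Lower semicontinuity would push \<open>f (X k)\<close> above \<open>B\<close>,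
      whereas \<open>Fr (X k) \<le> H 0\<close> eventually keeps it below.\<close>
    define B where "B = H 0 - h (A xs) + real_of_ereal (g xs) + 1"
    have "(\<lambda>k. H 0 - h (A (X k)) + real_of_ereal (g (X k))) \<longlonglongrightarrow> H 0 - h (A xs) + real_of_ereal (g xs)"
      by (intro tendsto_intros gX hX)
    then have "\<forall>\<^sub>F k in sequentially. H 0 - h (A (X k)) + real_of_ereal (g (X k)) < B"
      by (rule order_tendstoD) (simp add: B_def)
    moreover have "\<forall>\<^sub>F k in sequentially. ereal B < f (X k)"
      using X by (intro lsc_eventually) (simp_all add: \<open>f xs = \<infinity>\<close>)
    ultimately have "\<forall>\<^sub>F k in sequentially. False"
    proof eventually_elim
      case (elim k)
      have "B < real_of_ereal (f (X k))"
        using elim(2) fX[of k] by (metis less_ereal.simps(1))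
      moreover have "Fr (X k) \<le> H 0"
        using Fr_le_H[of "r k"] decseqD[OF H_decseq, of 0 "r k"] by (simp add: X_def)
      ultimately show False using elim(1) by (simp add: Fr_def)
    qed
    then show False by simp
  qed
  then have xs: "xs \<in> C \<inter> edom f" using C_xs by simp
  have \<Delta>r: "(\<lambda>k. \<Delta> (r k)) \<longlonglongrightarrow> 0"
    by (rule filterlim_compose[OF \<Delta>_tendsto r_top])
  have dr: "(\<lambda>k. d_prev (r k)) \<longlonglongrightarrow> 0"
  proof -
    have "(\<lambda>n. d_prev (Suc n)) \<longlonglongrightarrow> 0" using \<Delta>_tendsto by simp
    then have "d_prev \<longlonglongrightarrow> 0" by (rule LIMSEQ_imp_Suc)
    then show ?thesis by (rule filterlim_compose[OF _ r_top])
  qed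
  have xr: "(\<lambda>k. x (r k)) \<longlonglongrightarrow> xs"
    using tendsto_diff[OF X \<Delta>r] by (simp add: X_def \<Delta>_def)
  obtain t0 where t0: "0 < t0" "\<And>n. t0 \<le> \<tau> n" using \<tau>_lower_bound by blast
  have ur: "(\<lambda>k. u (r k)) \<longlonglongrightarrow> xs"
  proof -
    have "(\<lambda>k. lam (r k) *\<^sub>R d_prev (r k)) \<longlonglongrightarrow> 0"
    proof (rule tendsto_norm_zero_cancel, rule tendsto_sandwich[OF _ _ tendsto_const])
      show "(\<lambda>k. lam_bar * norm (d_prev (r k))) \<longlonglongrightarrow> 0"
        using tendsto_mult_right_zero[OF tendsto_norm_zero[OF dr]] .
      show "\<forall>\<^sub>F k in sequentially. norm (lam (r k) *\<^sub>R d_prev (r k)) \<le> lam_bar * norm (d_prev (r k))"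
        using alg_step(3,4) by (intro always_eventually allI) (simp add: mult_right_mono)
    qed simp
    from tendsto_add[OF xr this] show ?thesis by (simp add: u_def)
  qed
  have vr: "(\<lambda>k. v (r k)) \<longlonglongrightarrow> xs"
  proof -
    define B where "B = \<beta> + 2 * \<delta> + l * (onorm A)\<^sup>2 * (2 * lam_bar + 1) + 2 * mu_bar"
    have \<mu>_le: "\<mu> n \<le> mu_bar * (1 / B)" for n
      using alg_step(2,6)[of n] params unfolding B_def by (meson mult_left_mono order_trans)
    have "(\<lambda>k. \<mu> (r k) *\<^sub>R d_prev (r k)) \<longlonglongrightarrow> 0"
    proof (rule tendsto_norm_zero_cancel, rule tendsto_sandwich[OF _ _ tendsto_const])
      show "(\<lambda>k. mu_bar * (1 / B) * norm (d_prev (r k))) \<longlonglongrightarrow> 0"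
        using tendsto_mult_right_zero[OF tendsto_norm_zero[OF dr]] .
      show "\<forall>\<^sub>F k in sequentially. norm (\<mu> (r k) *\<^sub>R d_prev (r k)) \<le> mu_bar * (1 / B) * norm (d_prev (r k))"
        unfolding norm_scaleR using alg_step(5) \<mu>_le by (intro always_eventually allI mult_right_mono) auto
    qed simp
    from tendsto_add[OF xr this] show ?thesis by (simp add: v_def)
  qed
  have wr: "(\<lambda>k. w (r k)) \<longlonglongrightarrow> adjoint A (grad_h (A xs))"
  proof -
    have "continuous_on UNIV grad_h" using h(2) by (rule lipschitz_on_continuous_on)
    then have 1: "isCont grad_h z" for z by (simp add: continuous_on_eq_continuous_at)
    have 2: "isCont A z" for z using bounded_linear_A by (simp add: linear_continuous_at)
    have "bounded_linear (adjoint A)"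
      using adjoint_linear[OF A] by (simp add: linear_conv_bounded_linear)
    then have 3: "isCont (adjoint A) z" for z by (simp add: linear_continuous_at)
    show ?thesis
      unfolding w_def
      by (rule isCont_tendsto_compose[OF 3], rule isCont_tendsto_compose[OF 1],
          rule isCont_tendsto_compose[OF 2 ur])
  qed
  have gsr: "(\<lambda>k. gs (r k)) \<longlonglongrightarrow> grad_g xs"
  proof -
    have ev: "\<forall>\<^sub>F k in sequentially. x (r k) \<in> C \<inter> edom f"
    proof -
      \<comment> \<open>Excludes the initial point, which may lie outside the domain of
        \<open>f\<close>.\<close>
      have "\<forall>\<^sub>F k in sequentially. 1 \<le> r k"
        using r_top by (simp add: filterlim_at_top)
      then show ?thesis
      proof eventually_elim
        case (elim k)
        then show ?case using x_Suc_in[of "r k - 1"] by simp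
      qed
    qed
    have "continuous_on (C \<inter> edom f) grad_g" using g_on_U(3) by (rule lipschitz_on_continuous_on)
    then have "(\<lambda>k. grad_g (x (r k))) \<longlonglongrightarrow> grad_g xs"
      using xr xs ev by (rule continuous_on_tendsto_compose)
    moreover have "\<forall>\<^sub>F k in sequentially. grad_g (x (r k)) = gs (r k)"
      using ev by eventually_elim (simp add: gs_eq_grad)
    ultimately show ?thesis by (rule Lim_transform_eventually)
  qed
  \<comment> \<open>The absolute value lets the varying factor \<open>1 / (2 * \<tau> (r k))\<close>
    be replaced by its upper bound \<open>1 / (2 * t0)\<close>, whatever the sign of the difference
    of squares.\<close>
  define err where "err k = (w (r k) - gs (r k)) \<bullet> (xs - X k)
    + 1 / (2 * t0) * \<bar>(norm (xs - v (r k)))\<^sup>2 - (norm (X k - v (r k)))\<^sup>2\<bar>" for k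
  have "err \<longlonglongrightarrow> (adjoint A (grad_h (A xs)) - grad_g xs) \<bullet> (xs - xs)
    + 1 / (2 * t0) * \<bar>(norm (xs - xs))\<^sup>2 - (norm (xs - xs))\<^sup>2\<bar>"
    unfolding err_def by (intro tendsto_intros wr gsr vr X)
  then have err: "err \<longlonglongrightarrow> 0" by simp
  have up: "real_of_ereal (f (X k)) \<le> real_of_ereal (f xs) + err k" for k
  proof -
    let ?z = "(norm (xs - v (r k)))\<^sup>2 - (norm (X k - v (r k)))\<^sup>2"
    have "1 / (2 * \<tau> (r k)) * ?z \<le> 1 / (2 * \<tau> (r k)) * \<bar>?z\<bar>"
      using alg_step(1)[of "r k"] by (intro mult_left_mono) auto
    also have "\<dots> \<le> 1 / (2 * t0) * \<bar>?z\<bar>"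
      using t0 by (intro mult_right_mono divide_left_mono) (auto intro: mult_pos_pos less_le_trans)
    finally show ?thesis
      using optimality[OF xs, of "r k"] unfolding err_def X_def by linarith
  qed
  have fr: "(\<lambda>k. real_of_ereal (f (X k))) \<longlonglongrightarrow> real_of_ereal (f xs)"
  proof (rule order_tendstoI)
    fix a assume "a < real_of_ereal (f xs)"
    then have "ereal a < f xs" using f_finite[OF dom_xs] by (metis less_ereal.simps(1))
    from lsc_eventually[OF this X] show "\<forall>\<^sub>F k in sequentially. a < real_of_ereal (f (X k))"
      by eventually_elim (metis fX less_ereal.simps(1))
  next
    fix a assume "real_of_ereal (f xs) < a"
    then have "\<forall>\<^sub>F k in sequentially. err k < a - real_of_ereal (f xs)"
      using err by (intro order_tendstoD) auto
    then show "\<forall>\<^sub>F k in sequentially. real_of_ereal (f (X k)) < a"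
    proof eventually_elim
      case (elim k)
      with up[of k] show ?case by linarith
    qed
  qed
  have "(\<lambda>k. H (r k)) \<longlonglongrightarrow> (real_of_ereal (f xs) + h (A xs) - real_of_ereal (g xs)) + c * (norm (0 :: 'a))\<^sup>2"
    unfolding H_def Fr_def X_def[symmetric] by (intro tendsto_intros fr gX hX \<Delta>r)
  then have "(\<lambda>k. H (r k)) \<longlonglongrightarrow> Fr xs" by (simp add: Fr_def)
  moreover have "(\<lambda>k. H (r k)) \<longlonglongrightarrow> L" by (rule filterlim_compose[OF L r_top])
  ultimately have "L = Fr xs" by (rule LIMSEQ_unique[rotated])
  with L xs r(1) X show ?thesis unfolding X_def by blast
qed

section \<open>The merit function and its subgradients\<close>

definition FC :: "'a \<Rightarrow> ereal" where "FC y = F y + indicat_inf C y"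

definition G :: "'a \<times> 'a \<Rightarrow> ereal" where
  "G = (\<lambda>(y, z). F y + indicat_inf C y + ereal (c * (norm (y - z))\<^sup>2))"

lemma G_eq: "G = (\<lambda>(y, z). FC y + ereal (c * (norm (y - z))\<^sup>2))"
  by (simp add: G_def FC_def)

lemma FC_finite:
  assumes "y \<in> C \<inter> edom f" shows "FC y = ereal (Fr y)"
  using F_finite[OF assms] assms by (simp add: FC_def indicat_inf_def)

lemma FC_infinite:
  assumes "y \<notin> C \<inter> edom f" shows "FC y = \<infinity>"
proof (cases "y \<in> C")
  case True
  then show ?thesis using F_infinite[of y] assms by (simp add: FC_def indicat_inf_def)
next
  case False
  then show ?thesis by (simp add: FC_def indicat_inf_def)
qed

lemma G_step: "G (x (Suc n), x n) = ereal (H n)"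
  using FC_finite[OF x_Suc_in[of n]] by (simp add: G_eq H_def \<Delta>_def)

lemma G_diagonal: "y \<in> C \<inter> edom f \<Longrightarrow> G (y, y) = ereal (Fr y)"
  using FC_finite[of y] by (simp add: G_eq)

text \<open>Optimality of \<open>x (Suc n)\<close>, solved for a subgradient of \<open>f\<close>
  plus the indicator of \<open>C\<close>, gives the first three terms; the last two are the gradient
  of the remaining part of \<open>FC\<close> at the new point.\<close>

definition sg :: "nat \<Rightarrow> 'a" where
  "sg n = (1 / \<tau> n) *\<^sub>R (v n - x (Suc n)) - w n + gs n
    + adjoint A (grad_h (A (x (Suc n)))) - grad_g (x (Suc n))"

lemma gderiv_hA: "GDERIV (\<lambda>z. h (A z)) y :> adjoint A (grad_h (A y))"
proof -
  have "(h has_derivative (\<lambda>k. k \<bullet> grad_h (A y))) (at (A y))"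
    using h(1) by (simp add: gderiv_def)
  moreover have "(A has_derivative A) (at y)"
    by (rule bounded_linear_imp_has_derivative[OF bounded_linear_A])
  ultimately have "((\<lambda>z. h (A z)) has_derivative (\<lambda>k. A k \<bullet> grad_h (A y))) (at y)"
    by (rule has_derivative_compose[rotated])
  then show ?thesis
    unfolding gderiv_def by (rule has_derivative_eq_rhs) (simp add: adjoint_works[OF A])
qed

lemma sg_frechet: "sg n \<in> frechet_subdiff FC (x (Suc n))"
proof -
  define z where "z = v n - \<tau> n *\<^sub>R w n + \<tau> n *\<^sub>R gs n"
  define x' where "x' = x (Suc n)"
  define t where "t = 1 / (2 * \<tau> n)"
  define \<psi> where "\<psi> y = f y + ereal (t * (norm (y - z))\<^sup>2)" for y
  \<comment> \<open>\<open>q\<close> replaces the proximal model by the true objective: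
    \<open>\<psi> y + q y\<close> is \<open>F y\<close> on \<open>C \<inter> edom f\<close>.\<close>
  define q where "q y = h (A y) - real_of_ereal (g y) - t * (norm (y - z))\<^sup>2" for y
  have x': "x' \<in> C \<inter> edom f" using x_Suc_in by (simp add: x'_def)
  have ninf: "\<psi> y \<noteq> -\<infinity>" for y
    using f(1) by (simp add: \<psi>_def eproper_def)
  have z: "y - v n + \<tau> n *\<^sub>R w n - \<tau> n *\<^sub>R gs n = y - z" for y
    by (simp add: z_def)
  have "x' \<in> argmin_on C \<psi>"
    using alg_step(8)[of n] unfolding \<psi>_def[abs_def] x'_def t_def z .
  then have 0: "0 \<in> frechet_subdiff (\<lambda>y. \<psi> y + indicat_inf C y) x'"
    using ninf by (intro argmin_on_frechet) auto
  have "GDERIV q x' :> adjoint A (grad_h (A x')) - grad_g x' - (2 * t) *\<^sub>R (x' - z)"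
  proof -
    have "GDERIV (\<lambda>w. real_of_ereal (g w)) x' :> grad_g x'"
      using g_on_U(2) U(2) x' by blast
    then show ?thesis unfolding q_def by (intro GDERIV_diff gderiv_hA gderiv_sq_dist)
  qed
  moreover have fin: "\<psi> y + indicat_inf C y + ereal (q y) = FC y" if y: "y \<in> C \<inter> edom f" for y
  proof -
    have "f y = ereal (real_of_ereal (f y))" using y f_finite by blast
    then obtain a where a: "f y = ereal a" by blast
    have "FC y = ereal (a + h (A y) - real_of_ereal (g y))"
      using FC_finite[OF y] by (simp add: Fr_def a)
    then show ?thesis using y by (simp add: \<psi>_def q_def a indicat_inf_def)
  qed
  \<comment> \<open>Off \<open>C \<inter> edom f\<close> the right side is infinite, and the
    one-sided hypothesis of \<open>frechet_subdiff_add\<close> is enough.\<close>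
  moreover have "\<psi> y + indicat_inf C y + ereal (q y) \<le> FC y" for y
    using fin[of y] FC_infinite[of y] by (cases "y \<in> C \<inter> edom f") simp_all
  ultimately have "0 + (adjoint A (grad_h (A x')) - grad_g x' - (2 * t) *\<^sub>R (x' - z)) \<in> frechet_subdiff FC x'"
    using x' by (intro frechet_subdiff_add[OF 0]) auto
  moreover have "(2 * t) *\<^sub>R (x' - z) = (1 / \<tau> n) *\<^sub>R (x' - v n) + w n - gs n"
    using alg_step(1)[of n] by (simp add: t_def z_def scaleR_diff_right scaleR_add_right)
  then have "0 + (adjoint A (grad_h (A x')) - grad_g x' - (2 * t) *\<^sub>R (x' - z)) = sg n"
    by (simp add: sg_def x'_def scaleR_diff_right)
  ultimately show ?thesis
    by (simp only: x'_def)
qed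

text \<open>\<open>sg\<close> splits into three differences controlled by steps: the proximal
  residual, the change of the gradient of \<open>h\<close> composed with \<open>A\<close> from
  \<open>u\<close> to the new iterate, and the change of \<open>grad_g\<close> between consecutive
  iterates. The last one needs \<open>x m\<close> in the domain of \<open>f\<close>, hence the index
  \<open>Suc n\<close>.\<close>

lemma sg_bound: "\<exists>K>0. \<forall>n. norm (sg (Suc n)) \<le> K * (norm (\<Delta> (Suc n)) + norm (\<Delta> n))"
proof -
  obtain t0 where t0: "0 < t0" "\<And>n. t0 \<le> \<tau> n" using \<tau>_lower_bound by blast
  define Q where "Q = l * (onorm A)\<^sup>2"
  have Q: "0 \<le> Q" using l_nonneg by (simp add: Q_def)
  have l_g: "0 \<le> l_g" using g_on_U(3) by (rule lipschitz_on_nonneg)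
  \<comment> \<open>\<open>mu_bar\<close> bounds \<open>\<mu> m / \<tau> m\<close> and
    \<open>1 / t0\<close> bounds \<open>1 / \<tau> m\<close>.\<close>
  define K where "K = 1 / t0 + mu_bar + Q * (1 + lam_bar) + l_g"
  have K: "0 < K" using t0 params Q l_g by (simp add: K_def add_pos_nonneg)
  have "norm (sg m) \<le> K * (norm (\<Delta> m) + norm (d_prev m))" if m: "m = Suc n" for m n
  proof -
    have \<tau>: "0 < \<tau> m" by (rule alg_step)
    have 1: "norm ((1 / \<tau> m) *\<^sub>R (v m - x (Suc m))) \<le> 1 / t0 * norm (\<Delta> m) + mu_bar * norm (d_prev m)"
    proof -
      have "(1 / \<tau> m) *\<^sub>R (v m - x (Suc m)) = (\<mu> m / \<tau> m) *\<^sub>R d_prev m - (1 / \<tau> m) *\<^sub>R \<Delta> m"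
        unfolding v_def \<Delta>_def by (simp add: scaleR_diff_right scaleR_add_right)
      then have "norm ((1 / \<tau> m) *\<^sub>R (v m - x (Suc m))) \<le> norm ((\<mu> m / \<tau> m) *\<^sub>R d_prev m) + norm ((1 / \<tau> m) *\<^sub>R \<Delta> m)"
        by (metis norm_triangle_ineq4)
      also have "\<dots> = \<mu> m / \<tau> m * norm (d_prev m) + 1 / \<tau> m * norm (\<Delta> m)"
        using \<tau> alg_step(5)[of m] by simp
      also have "\<dots> \<le> mu_bar * norm (d_prev m) + 1 / t0 * norm (\<Delta> m)"
        using \<tau> t0(1) t0(2)[of m] alg_step(6)[of m]
        by (intro add_mono mult_right_mono divide_left_mono) (auto simp: field_simps)
      finally show ?thesis by simp
    qed
    have 2: "norm (adjoint A (grad_h (A (x (Suc m)))) - w m) \<le> Q * (norm (\<Delta> m) + lam_bar * norm (d_prev m))"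
    proof -
      have "adjoint A (grad_h (A (x (Suc m)))) - w m = adjoint A (grad_h (A (x (Suc m))) - grad_h (A (u m)))"
        unfolding w_def by (rule linear_diff[OF adjoint_linear[OF A], symmetric])
      then have "norm (adjoint A (grad_h (A (x (Suc m)))) - w m)
          \<le> onorm A * norm (grad_h (A (x (Suc m))) - grad_h (A (u m)))"
        using norm_adjoint_le[OF A] by metis
      also have "\<dots> \<le> onorm A * (l * norm (A (x (Suc m) - u m)))"
        using lipschitz_onD[OF h(2), of "A (x (Suc m))" "A (u m)"] onorm_A_nonneg
        by (intro mult_left_mono) (auto simp: dist_norm linear_diff[OF A])
      also have "\<dots> \<le> onorm A * (l * (onorm A * norm (x (Suc m) - u m)))"
        using norm_A_le onorm_A_nonneg l_nonneg by (intro mult_left_mono) auto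
      also have "\<dots> = Q * norm (x (Suc m) - u m)"
        by (simp add: Q_def power2_eq_square)
      also have "\<dots> \<le> Q * (norm (\<Delta> m) + lam_bar * norm (d_prev m))"
      proof (rule mult_left_mono[OF _ Q])
        have "x (Suc m) - u m = \<Delta> m - lam m *\<^sub>R d_prev m"
          by (simp add: u_def \<Delta>_def)
        then have "norm (x (Suc m) - u m) \<le> norm (\<Delta> m) + norm (lam m *\<^sub>R d_prev m)"
          by (metis norm_triangle_ineq4)
        also have "norm (lam m *\<^sub>R d_prev m) \<le> lam_bar * norm (d_prev m)"
          using alg_step(3,4)[of m] by (simp add: mult_right_mono)
        finally show "norm (x (Suc m) - u m) \<le> norm (\<Delta> m) + lam_bar * norm (d_prev m)" by simp
      qed
      finally show ?thesis .
    qed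
    have 3: "norm (gs m - grad_g (x (Suc m))) \<le> l_g * norm (\<Delta> m)"
    proof -
      have xm: "x m \<in> C \<inter> edom f" unfolding m by (rule x_Suc_in)
      then have "gs m = grad_g (x m)" by (intro gs_eq_grad) simp
      then show ?thesis
        using lipschitz_onD[OF g_on_U(3) xm x_Suc_in[of m]]
        by (simp add: dist_norm \<Delta>_def norm_minus_commute)
    qed
    have "sg m = (1 / \<tau> m) *\<^sub>R (v m - x (Suc m)) + (adjoint A (grad_h (A (x (Suc m)))) - w m)
        + (gs m - grad_g (x (Suc m)))"
      by (simp add: sg_def)
    also have "norm \<dots> \<le> (1 / t0 * norm (\<Delta> m) + mu_bar * norm (d_prev m))
        + Q * (norm (\<Delta> m) + lam_bar * norm (d_prev m)) + l_g * norm (\<Delta> m)"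
      using 1 2 3 by (intro norm_triangle_mono)
    also have "\<dots> = (1 / t0 + Q + l_g) * norm (\<Delta> m) + (mu_bar + Q * lam_bar) * norm (d_prev m)"
      by (simp add: algebra_simps)
    also have "\<dots> \<le> K * norm (\<Delta> m) + K * norm (d_prev m)"
    proof (intro add_mono mult_right_mono)
      have "0 \<le> Q * lam_bar" "0 \<le> 1 / t0" using Q params t0 by simp_all
      then show "1 / t0 + Q + l_g \<le> K" "mu_bar + Q * lam_bar \<le> K"
        using Q l_g params unfolding K_def distrib_left by linarith+
    qed simp_all
    finally show ?thesis by (simp only: distrib_left)
  qed
  then show ?thesis using K by (metis d_prev_Suc)
qed

lemma dist0_G_bound:
  "\<exists>K>0. \<forall>n. dist0 (limiting_subdiff G (x (Suc (Suc n)), x (Suc n))) \<le> ereal (K * (norm (\<Delta> (Suc n)) + norm (\<Delta> n)))"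
proof -
  obtain K where K: "0 < K" "\<And>n. norm (sg (Suc n)) \<le> K * (norm (\<Delta> (Suc n)) + norm (\<Delta> n))"
    using sg_bound by blast
  \<comment> \<open>Both components of the coupling gradient have norm
    \<open>2 * c * norm (\<Delta> (Suc n))\<close>, whence \<open>4 * c\<close>.\<close>
  have "dist0 (limiting_subdiff G (x (Suc (Suc n)), x (Suc n))) \<le> ereal ((K + 4 * c) * (norm (\<Delta> (Suc n)) + norm (\<Delta> n)))" for n
  proof -
    let ?p = "(sg (Suc n) + (2 * c) *\<^sub>R (x (Suc (Suc n)) - x (Suc n)), (2 * c) *\<^sub>R (x (Suc n) - x (Suc (Suc n))))"
    have "?p \<in> frechet_subdiff G (x (Suc (Suc n)), x (Suc n))"
      unfolding G_eq by (rule frechet_subdiff_coupled[OF sg_frechet])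
    then have d0: "dist0 (limiting_subdiff G (x (Suc (Suc n)), x (Suc n))) \<le> ereal (norm ?p)"
      using frechet_subset_limiting by (intro dist0_le) blast
    have "norm ?p \<le> norm (sg (Suc n) + (2 * c) *\<^sub>R \<Delta> (Suc n)) + norm ((2 * c) *\<^sub>R (x (Suc n) - x (Suc (Suc n))))"
      unfolding \<Delta>_def by (rule norm_Pair_le)
    also have "\<dots> \<le> norm (sg (Suc n)) + 4 * c * norm (\<Delta> (Suc n))"
      using norm_triangle_ineq[of "sg (Suc n)" "(2 * c) *\<^sub>R \<Delta> (Suc n)"] c_nonneg
      by (simp add: \<Delta>_def norm_minus_commute)
    also have "\<dots> \<le> K * (norm (\<Delta> (Suc n)) + norm (\<Delta> n)) + 4 * c * (norm (\<Delta> (Suc n)) + norm (\<Delta> n))"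
      using K(2)[of n] c_nonneg by (intro add_mono mult_left_mono) auto
    finally have "norm ?p \<le> (K + 4 * c) * (norm (\<Delta> (Suc n)) + norm (\<Delta> n))"
      by (simp only: distrib_right)
    then show ?thesis
      by (intro order_trans[OF d0]) (simp only: ereal_less_eq)
  qed
  moreover have "0 < K + 4 * c" using K c_nonneg by simp
  ultimately show ?thesis by blast
qed

text \<open>The starting point is dropped, because \<open>F\<close> may be infinite there.\<close>

definition X :: "nat \<Rightarrow> 'a" where "X n = x (Suc n)"

definition E :: "'a \<Rightarrow> nat \<Rightarrow> real" where "E xs n = H n - Fr xs"

section \<open>The iterates as a descent sequence\<close>

lemma norm_X_diff: "norm (X (Suc n) - X n) = norm (\<Delta> (Suc n))"
  by (simp add: X_def \<Delta>_def)

lemma descent_sequence_X: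
  assumes "H \<longlonglongrightarrow> Fr xs" "0 < K"
  shows "descent_sequence X (E xs) \<delta> K"
proof
  show "0 \<le> E xs n" for n
    using decseq_ge[OF H_decseq assms(1)] by (simp add: E_def)
  show "E xs (Suc n) + \<delta> * (norm (X (Suc n) - X n))\<^sup>2 \<le> E xs n" for n
    using H_descent[of n] by (simp add: E_def norm_X_diff)
  show "E xs \<longlonglongrightarrow> 0"
    using tendsto_diff[OF assms(1) tendsto_const[of "Fr xs"]] by (simp add: E_def[abs_def])
qed (use params assms in auto)

lemma KL_descent_sequence_X:
  assumes xs: "xs \<in> C \<inter> edom f" and lim: "H \<longlonglongrightarrow> Fr xs" and KL: "KL_with G (xs, xs) \<phi>"
  obtains K \<phi>' \<eta> V where "KL_descent_sequence X (E xs) \<delta> K xs \<phi> \<phi>' \<eta> V"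
proof -
  obtain K where K: "0 < K" "\<And>n. dist0 (limiting_subdiff G (x (Suc (Suc n)), x (Suc n)))
      \<le> ereal (K * (norm (\<Delta> (Suc n)) + norm (\<Delta> n)))"
    using dist0_G_bound by blast
  obtain \<eta> :: ereal and V \<phi>' where *:
      "0 < \<eta>" "open V" "(xs, xs) \<in> V"
      "continuous_on {t. 0 \<le> t \<and> ereal t < \<eta>} \<phi>"
      "concave_on {t. 0 \<le> t \<and> ereal t < \<eta>} \<phi>"
      "\<And>t. 0 \<le> t \<Longrightarrow> ereal t < \<eta> \<Longrightarrow> 0 \<le> \<phi> t"
      "\<phi> 0 = 0"
      "\<And>t. 0 < t \<Longrightarrow> ereal t < \<eta> \<Longrightarrow> (\<phi> has_real_derivative \<phi>' t) (at t)"
      "\<And>t. 0 < t \<Longrightarrow> ereal t < \<eta> \<Longrightarrow> 0 < \<phi>' t"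
    and ineq: "\<And>w. w \<in> V \<Longrightarrow> G (xs, xs) < G w \<Longrightarrow> G w < G (xs, xs) + \<eta> \<Longrightarrow>
           1 \<le> ereal (\<phi>' (real_of_ereal (G w - G (xs, xs)))) * dist0 (limiting_subdiff G w)"
    using KL unfolding KL_with_def by blast
  interpret descent_sequence X "E xs" \<delta> K
    by (rule descent_sequence_X[OF lim K(1)])
  have "KL_descent_sequence X (E xs) \<delta> K xs \<phi> \<phi>' \<eta> V"
  proof (unfold_locales, fact *, fact *, fact *, fact *, fact *, fact *, fact *, fact *, fact *)
    fix n
    assume V: "(X (n + 2), X (n + 1)) \<in> V" and E: "0 < E xs (n + 2)" "ereal (E xs (n + 2)) < \<eta>"
    let ?w = "(X (n + 2), X (n + 1))"
    have Gw: "G ?w = ereal (H (n + 2))"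
      using G_step[of "n + 2"] by (simp add: X_def)
    have Gz: "G (xs, xs) = ereal (Fr xs)" by (rule G_diagonal[OF xs])
    have "G (xs, xs) < G ?w"
      using E(1) by (simp only: Gw Gz) (simp add: E_def)
    moreover have "G ?w < G (xs, xs) + \<eta>"
      using E(2) by (simp only: Gw Gz) (cases \<eta>; simp add: E_def)
    moreover have "real_of_ereal (G ?w - G (xs, xs)) = E xs (n + 2)"
      by (simp only: Gw Gz) (simp add: E_def)
    ultimately have 1: "1 \<le> ereal (\<phi>' (E xs (n + 2))) * dist0 (limiting_subdiff G ?w)"
      using ineq[OF V] by metis
    \<comment> \<open>\<open>d n\<close> is the norm of \<open>\<Delta> (Suc n)\<close>, which
      accounts for the instance \<open>n + 1\<close>.\<close>
    have "dist0 (limiting_subdiff G ?w) \<le> ereal (K * (d (n + 1) + d n))"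
      using K(2)[of "n + 1"] unfolding d_def norm_X_diff by (simp add: X_def)
    then have "ereal (\<phi>' (E xs (n + 2))) * dist0 (limiting_subdiff G ?w)
        \<le> ereal (\<phi>' (E xs (n + 2))) * ereal (K * (d (n + 1) + d n))"
      using *(9)[OF E] by (intro ereal_mult_left_mono) simp_all
    with 1 have "1 \<le> ereal (\<phi>' (E xs (n + 2))) * ereal (K * (d (n + 1) + d n))"
      by (rule order_trans)
    then show "1 \<le> \<phi>' (E xs (n + 2)) * (K * (d (n + 1) + d n))"
      by (simp add: one_ereal_def)
  qed
  then show thesis by (rule that)
qed

text \<open>The coupling term inside \<open>H\<close> is at most \<open>c / \<delta>\<close> times
  an energy drop. Once it is removed, the value may lie below \<open>Fr xs\<close>, hence the
  absolute value.\<close>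

lemma Fr_diff_le:
  assumes lim: "H \<longlonglongrightarrow> Fr xs"
  shows "\<bar>Fr (x (n + 3)) - Fr xs\<bar> \<le> (1 + c / \<delta>) * E xs n"
proof -
  interpret descent_sequence X "E xs" \<delta> 1
    by (rule descent_sequence_X[OF lim]) simp
  define D where "D = (norm (\<Delta> (n + 2)))\<^sup>2"
  have D: "0 \<le> D" by (simp add: D_def)
  have E: "0 \<le> E xs (n + 2)" "E xs (n + 2) \<le> E xs (n + 1)" "E xs (n + 1) \<le> E xs n"
    by (rule E_nonneg, (rule E_decreasing, simp)+)
  have "\<delta> * D \<le> E xs (n + 1) - E xs (n + 2)"
    using d_sq_le[of "n + 1"] by (simp add: d_def norm_X_diff D_def)
  then have "\<delta> * D \<le> E xs n" using E by linarith
  then have "D \<le> E xs n / \<delta>" using params by (simp add: field_simps)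
  then have "c * D \<le> c * (E xs n / \<delta>)" using c_nonneg by (rule mult_left_mono)
  then have cD: "c * D \<le> c / \<delta> * E xs n" by simp
  have "Fr (x (n + 3)) - Fr xs = E xs (n + 2) - c * D"
    by (simp add: E_def H_def D_def eval_nat_numeral)
  moreover have "0 \<le> c * D" using c_nonneg D by simp
  ultimately have "\<bar>Fr (x (n + 3)) - Fr xs\<bar> \<le> E xs n + c / \<delta> * E xs n"
    using cD E by linarith
  then show ?thesis by (simp only: distrib_right mult_1)
qed

text \<open>If \<open>F (x 0)\<close> is infinite, so is its distance to \<open>F xs\<close>; the
  second hypothesis rules this case out.\<close>

lemma abs_F_diff:
  assumes "xs \<in> C \<inter> edom f" "F (x 0) < \<infinity> \<or> 1 \<le> n" "\<bar>Fr (x n) - Fr xs\<bar> \<le> B"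
  shows "\<bar>F (x n) - F xs\<bar> \<le> ereal B"
proof -
  have "x n \<in> C \<inter> edom f"
  proof (cases n)
    case 0
    then show ?thesis using assms(2) F_infinite x_in_C by force
  next
    case (Suc m)
    then show ?thesis using x_Suc_in by simp
  qed
  then show ?thesis using F_finite assms by simp
qed

lemma stationary:
  assumes xs: "xs \<in> C \<inter> edom f" and lim: "H \<longlonglongrightarrow> Fr xs" and x_lim: "x \<longlonglongrightarrow> xs"
  shows "stationary_point C f h A g xs"
proof -
  have eq: "(\<lambda>y. f y + indicat_inf C y + ereal (h (A y)) - g y) = FC"
  proof
    fix y
    \<comment> \<open>Off \<open>C\<close> both sides are \<open>\<infinity>\<close>, even where
      \<open>g\<close> is infinite, by the convention for
      \<open>\<infinity> + (- \<infinity>)\<close>.\<close>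
    show "f y + indicat_inf C y + ereal (h (A y)) - g y = FC y"
      by (cases "y \<in> C"; cases "g y"; cases "f y") (auto simp: FC_def objective_def indicat_inf_def)
  qed
  obtain K where K: "0 < K" "\<And>n. norm (sg (Suc n)) \<le> K * (norm (\<Delta> (Suc n)) + norm (\<Delta> n))"
    using sg_bound by blast
  have sg0: "(\<lambda>n. sg (Suc n)) \<longlonglongrightarrow> 0"
  proof (rule tendsto_norm_zero_cancel, rule tendsto_sandwich[OF _ _ tendsto_const])
    have "(\<lambda>n. K * (norm (\<Delta> (Suc n)) + norm (\<Delta> n))) \<longlonglongrightarrow> K * (norm (0::'a) + norm (0::'a))"
      by (intro tendsto_intros LIMSEQ_Suc \<Delta>_tendsto)
    then show "(\<lambda>n. K * (norm (\<Delta> (Suc n)) + norm (\<Delta> n))) \<longlonglongrightarrow> 0" by simp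
    show "\<forall>\<^sub>F n in sequentially. norm (sg (Suc n)) \<le> K * (norm (\<Delta> (Suc n)) + norm (\<Delta> n))"
      using K(2) by (intro always_eventually allI)
  qed simp
  \<comment> \<open>The coupling term tends to 0, so the values of \<open>F\<close> converge with
    the energy, as the limiting subdifferential requires.\<close>
  have "(\<lambda>n. H n - c * (norm (\<Delta> n))\<^sup>2) \<longlonglongrightarrow> Fr xs - c * (norm (0::'a))\<^sup>2"
    by (intro tendsto_intros lim \<Delta>_tendsto)
  then have "(\<lambda>n. Fr (x (Suc n))) \<longlonglongrightarrow> Fr xs" by (simp add: H_def)
  then have "(\<lambda>n. ereal (Fr (x (Suc (Suc n))))) \<longlonglongrightarrow> ereal (Fr xs)"
    by (rule tendsto_ereal[OF LIMSEQ_Suc])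
  then have "(\<lambda>n. FC (x (Suc (Suc n)))) \<longlonglongrightarrow> FC xs"
    using FC_finite[OF x_Suc_in] FC_finite[OF xs] by simp
  moreover have "(\<lambda>n. x (Suc (Suc n))) \<longlonglongrightarrow> xs"
    by (intro LIMSEQ_Suc x_lim)
  ultimately have "0 \<in> limiting_subdiff FC xs"
    unfolding limiting_subdiff_def using sg0 sg_frechet FC_finite[OF xs]
    by (intro CollectI conjI exI[of _ "\<lambda>n. x (Suc (Suc n))"] exI[of _ "\<lambda>n. sg (Suc n)"]) auto
  then show ?thesis
    using xs unfolding stationary_point_def eq by blast
qed

text \<open>Turns bounds on \<open>x (n + 3)\<close> and on the excess into bounds on
  \<open>x n\<close> and \<open>F (x n)\<close>, absorbing the initial segment into the constant.
  From \<open>k\<close> on the comparison sequences are positive: \<open>k\<close> is 0 for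
  geometric rates and 1 for negative powers of \<open>n\<close>.\<close>

lemma rate_transfer:
  fixes b1 b2 r1 r2 :: "nat \<Rightarrow> real"
  assumes xs: "xs \<in> C \<inter> edom f" and lim: "H \<longlonglongrightarrow> Fr xs"
    and rate: "\<forall>\<^sub>F n in sequentially. norm (X (n + 2) - xs) \<le> B * b1 n \<and> E xs n \<le> B * b2 n"
    and r: "\<forall>\<^sub>F n in sequentially. b1 n \<le> M1 * r1 (n + 3)" "\<forall>\<^sub>F n in sequentially. b2 n \<le> M2 * r2 (n + 3)"
    and pos: "0 < B" "\<And>n. k \<le> n \<Longrightarrow> 0 < r1 n" "\<And>n. k \<le> n \<Longrightarrow> 0 < r2 n"
  shows "\<exists>\<gamma>>0. \<forall>n\<ge>k. norm (x n - xs) \<le> \<gamma> * r1 n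
    \<and> (F (x 0) < \<infinity> \<or> 1 \<le> n \<longrightarrow> \<bar>F (x n) - F xs\<bar> \<le> ereal (\<gamma> * r2 n))"
proof -
  have "\<forall>\<^sub>F n in sequentially. norm (x (n + 3) - xs) \<le> (B * M1) * r1 (n + 3)"
    using rate r(1)
  proof eventually_elim
    case (elim n)
    have "B * b1 n \<le> B * (M1 * r1 (n + 3))" using elim pos by (intro mult_left_mono) auto
    then show ?case using elim(1) by (simp add: X_def eval_nat_numeral)
  qed
  then have 1: "\<forall>\<^sub>F n in sequentially. norm (x n - xs) \<le> (B * M1) * r1 n"
    by (rule eventually_shift3)
  define c' where "c' = 1 + c / \<delta>"
  have c': "0 \<le> c'" using c_nonneg params by (simp add: c'_def)
  have "\<forall>\<^sub>F n in sequentially. \<bar>Fr (x (n + 3)) - Fr xs\<bar> \<le> (c' * (B * M2)) * r2 (n + 3)"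
    using rate r(2)
  proof eventually_elim
    case (elim n)
    have "\<bar>Fr (x (n + 3)) - Fr xs\<bar> \<le> c' * E xs n"
      unfolding c'_def by (rule Fr_diff_le[OF lim])
    also have "\<dots> \<le> c' * (B * b2 n)" using elim c' by (intro mult_left_mono) auto
    also have "\<dots> \<le> c' * (B * (M2 * r2 (n + 3)))" using elim c' pos by (intro mult_left_mono) auto
    finally show ?case by (simp only: mult.assoc)
  qed
  then have 2: "\<forall>\<^sub>F n in sequentially. \<bar>Fr (x n) - Fr xs\<bar> \<le> (c' * (B * M2)) * r2 n"
    by (rule eventually_shift3)
  obtain \<gamma>1 where \<gamma>1: "0 < \<gamma>1" "\<And>\<gamma> n. \<gamma>1 \<le> \<gamma> \<Longrightarrow> k \<le> n \<Longrightarrow> norm (x n - xs) \<le> \<gamma> * r1 n"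
    using eventually_le_imp_le_from[OF 1 pos(2)] by metis
  obtain \<gamma>2 where \<gamma>2: "0 < \<gamma>2" "\<And>\<gamma> n. \<gamma>2 \<le> \<gamma> \<Longrightarrow> k \<le> n \<Longrightarrow> \<bar>Fr (x n) - Fr xs\<bar> \<le> \<gamma> * r2 n"
    using eventually_le_imp_le_from[OF 2 pos(3)] by metis
  show ?thesis
  proof (intro exI[of _ "max \<gamma>1 \<gamma>2"] conjI allI impI)
    fix n assume "k \<le> n"
    then show "norm (x n - xs) \<le> max \<gamma>1 \<gamma>2 * r1 n" by (intro \<gamma>1) auto
    assume "F (x 0) < \<infinity> \<or> 1 \<le> n"
    then show "\<bar>F (x n) - F xs\<bar> \<le> ereal (max \<gamma>1 \<gamma>2 * r2 n)"
      by (rule abs_F_diff[OF xs]) (use \<gamma>2 \<open>k \<le> n\<close> in auto)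
  qed (use \<gamma>1 in simp)
qed

section \<open>Convergence and rates combined\<close>

lemma convergence:
  assumes KL: "\<And>y. y \<in> C \<inter> edom f \<Longrightarrow> KL_property G (y, y)"
  shows "\<exists>xs.
    (x \<longlonglongrightarrow> xs \<and> stationary_point C f h A g xs \<and> summable (\<lambda>n. norm (x (Suc n) - x n))) \<and>
    (\<forall>\<theta>. 0 \<le> \<theta> \<and> \<theta> < 1 \<and> (\<forall>y \<in> C \<inter> edom f. KL_property_exponent G (y, y) \<theta>) \<longrightarrow>
      (\<theta> = 0 \<longrightarrow> (\<exists>N. \<forall>n\<ge>N. x n = xs)) \<and>
      (0 < \<theta> \<and> \<theta> \<le> 1 / 2 \<longrightarrow>
        (\<exists>\<gamma> \<rho>. 0 < \<gamma> \<and> 0 < \<rho> \<and> \<rho> < 1 \<and>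
          (\<forall>n. norm (x n - xs) \<le> \<gamma> * \<rho> powr (real n / 2) \<and>
               (F (x 0) < \<infinity> \<or> n \<ge> 1 \<longrightarrow> \<bar>F (x n) - F xs\<bar> \<le> ereal (\<gamma> * \<rho> ^ n))))) \<and>
      (1 / 2 < \<theta> \<longrightarrow>
        (\<exists>\<gamma>. 0 < \<gamma> \<and>
          (\<forall>n\<ge>1. norm (x n - xs) \<le> \<gamma> * real n powr (- ((1 - \<theta>) / (2 * \<theta> - 1))) \<and>
               \<bar>F (x n) - F xs\<bar> \<le> ereal (\<gamma> * real n powr (- ((2 - 2 * \<theta>) / (2 * \<theta> - 1))))))))"
proof -
  obtain xs r where r: "strict_mono (r :: nat \<Rightarrow> nat)" "(\<lambda>k. x (Suc (r k))) \<longlonglongrightarrow> xs"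
    and xs: "xs \<in> C \<inter> edom f" and lim: "H \<longlonglongrightarrow> Fr xs"
    using cluster_point by blast
  have sub: "(X \<circ> r) \<longlonglongrightarrow> xs" using r(2) by (simp add: X_def o_def)
  obtain \<phi> where "KL_with G (xs, xs) \<phi>"
    using KL[OF xs] unfolding KL_property_def by blast
  then obtain K \<phi>' \<eta> V where KLX: "KL_descent_sequence X (E xs) \<delta> K xs \<phi> \<phi>' \<eta> V"
    by (rule KL_descent_sequence_X[OF xs lim])
  have X_lim: "X \<longlonglongrightarrow> xs"
    by (rule KL_descent_sequence.convergent_to_cluster[OF KLX r(1) sub])
  then have x_lim: "x \<longlonglongrightarrow> xs"
    unfolding X_def[abs_def] by (rule LIMSEQ_imp_Suc)
  have "summable (\<lambda>n. norm (X (Suc n) - X n))"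
    using KL_descent_sequence.summable_d[OF KLX r(1) sub]
    unfolding descent_sequence.d_def[OF KL_descent_sequence.axioms(1)[OF KLX], abs_def] .
  then have summ: "summable (\<lambda>n. norm (x (Suc n) - x n))"
    unfolding X_def by (rule summable_Suc_iff[THEN iffD1])
  have rates: "(\<theta> = 0 \<longrightarrow> (\<exists>N. \<forall>n\<ge>N. x n = xs)) \<and>
      (0 < \<theta> \<and> \<theta> \<le> 1 / 2 \<longrightarrow>
        (\<exists>\<gamma> \<rho>. 0 < \<gamma> \<and> 0 < \<rho> \<and> \<rho> < 1 \<and>
          (\<forall>n. norm (x n - xs) \<le> \<gamma> * \<rho> powr (real n / 2) \<and>
               (F (x 0) < \<infinity> \<or> n \<ge> 1 \<longrightarrow> \<bar>F (x n) - F xs\<bar> \<le> ereal (\<gamma> * \<rho> ^ n))))) \<and>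
      (1 / 2 < \<theta> \<longrightarrow>
        (\<exists>\<gamma>. 0 < \<gamma> \<and>
          (\<forall>n\<ge>1. norm (x n - xs) \<le> \<gamma> * real n powr (- ((1 - \<theta>) / (2 * \<theta> - 1))) \<and>
               \<bar>F (x n) - F xs\<bar> \<le> ereal (\<gamma> * real n powr (- ((2 - 2 * \<theta>) / (2 * \<theta> - 1)))))))"
    if \<theta>: "0 \<le> \<theta>" "\<theta> < 1" "\<forall>y \<in> C \<inter> edom f. KL_property_exponent G (y, y) \<theta>" for \<theta>
  proof -
    obtain c0 where c0: "0 < c0" "KL_with G (xs, xs) (\<lambda>t. c0 * t powr (1 - \<theta>))"
      using \<theta>(3) xs unfolding KL_property_exponent_def by blast
    \<comment> \<open>The desingularizing function and its data are chosen anew for this exponent,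
      but the limit \<open>xs\<close> is the one already fixed.\<close>
    obtain K \<phi>' \<eta> V where KLX: "KL_descent_sequence X (E xs) \<delta> K xs (\<lambda>t. c0 * t powr (1 - \<theta>)) \<phi>' \<eta> V"
      by (rule KL_descent_sequence_X[OF xs lim c0(2)])
    note args = KLX refl c0(1) \<theta>(1,2) X_lim
    show ?thesis
    proof (intro conjI impI)
      assume "\<theta> = 0"
      then have "\<forall>\<^sub>F n in sequentially. x (Suc n) = xs"
        using KL_descent_sequence.finite_termination[OF args] by (simp add: X_def)
      then have "\<forall>\<^sub>F n in sequentially. x n = xs"
        by (rule eventually_sequentially_Suc[THEN iffD1])
      then show "\<exists>N. \<forall>n\<ge>N. x n = xs" by (simp add: eventually_sequentially)
    next
      assume "0 < \<theta> \<and> \<theta> \<le> 1 / 2"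
      then obtain B \<rho> where B: "0 < B" "0 < \<rho>" "\<rho> < 1"
        and rate: "\<forall>\<^sub>F n in sequentially. norm (X (n + 2) - xs) \<le> B * \<rho> powr (real n / 2) \<and> E xs n \<le> B * \<rho> ^ n"
        using KL_descent_sequence.linear_rate[OF args] by blast
      have "\<exists>\<gamma>>0. \<forall>n\<ge>0. norm (x n - xs) \<le> \<gamma> * \<rho> powr (real n / 2)
        \<and> (F (x 0) < \<infinity> \<or> 1 \<le> n \<longrightarrow> \<bar>F (x n) - F xs\<bar> \<le> ereal (\<gamma> * \<rho> ^ n))"
      proof (rule rate_transfer[OF xs lim rate])
        have "\<rho> powr (real n / 2) = \<rho> powr (- (3 / 2)) * \<rho> powr (real (n + 3) / 2)" for n
          unfolding powr_add[symmetric] by (simp add: field_simps)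
        then show "\<forall>\<^sub>F n in sequentially. \<rho> powr (real n / 2) \<le> \<rho> powr (- (3 / 2)) * \<rho> powr (real (n + 3) / 2)"
          by (intro always_eventually allI) (metis order_refl)
        show "\<forall>\<^sub>F n in sequentially. \<rho> ^ n \<le> (1 / \<rho> ^ 3) * \<rho> ^ (n + 3)"
          using B by (intro always_eventually allI) (simp add: power_add)
      qed (use B in auto)
      with B show "\<exists>\<gamma> \<rho>. 0 < \<gamma> \<and> 0 < \<rho> \<and> \<rho> < 1 \<and>
          (\<forall>n. norm (x n - xs) \<le> \<gamma> * \<rho> powr (real n / 2) \<and>
               (F (x 0) < \<infinity> \<or> n \<ge> 1 \<longrightarrow> \<bar>F (x n) - F xs\<bar> \<le> ereal (\<gamma> * \<rho> ^ n)))"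
        by blast
    next
      assume half: "1 / 2 < \<theta>"
      define a1 a2 where "a1 = (1 - \<theta>) / (2 * \<theta> - 1)" and "a2 = (2 - 2 * \<theta>) / (2 * \<theta> - 1)"
      have a: "0 \<le> a1" "0 \<le> a2" using half \<theta> by (simp_all add: a1_def a2_def)
      obtain B where B: "0 < B"
        and rate: "\<forall>\<^sub>F n in sequentially. norm (X (n + 2) - xs) \<le> B * real n powr (- a1) \<and> E xs n \<le> B * real n powr (- a2)"
        using KL_descent_sequence.sublinear_rate[OF args half] unfolding a1_def a2_def by blast
      have "\<exists>\<gamma>>0. \<forall>n\<ge>1. norm (x n - xs) \<le> \<gamma> * real n powr (- a1)
        \<and> (F (x 0) < \<infinity> \<or> 1 \<le> n \<longrightarrow> \<bar>F (x n) - F xs\<bar> \<le> ereal (\<gamma> * real n powr (- a2)))"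
      proof (rule rate_transfer[OF xs lim rate])
        show "\<forall>\<^sub>F n in sequentially. real n powr (- a1) \<le> 4 powr a1 * real (n + 3) powr (- a1)"
          using eventually_ge_at_top[of 1] by eventually_elim (rule powr_shift3[OF a(1)])
        show "\<forall>\<^sub>F n in sequentially. real n powr (- a2) \<le> 4 powr a2 * real (n + 3) powr (- a2)"
          using eventually_ge_at_top[of 1] by eventually_elim (rule powr_shift3[OF a(2)])
      qed (use B in auto)
      then show "\<exists>\<gamma>. 0 < \<gamma> \<and> (\<forall>n\<ge>1. norm (x n - xs) \<le> \<gamma> * real n powr (- ((1 - \<theta>) / (2 * \<theta> - 1))) \<and>
               \<bar>F (x n) - F xs\<bar> \<le> ereal (\<gamma> * real n powr (- ((2 - 2 * \<theta>) / (2 * \<theta> - 1)))))"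
        unfolding a1_def a2_def by blast
    qed
  qed
  show ?thesis
    using x_lim stationary[OF xs lim x_lim] summ rates by (intro exI[of _ xs]) blast
qed

end

theorem theorem3p4:
  fixes C D U :: "'a::euclidean_space set"
    and A :: "'a \<Rightarrow> 'b::euclidean_space"
    and f g F :: "'a \<Rightarrow> ereal"
    and h :: "'b \<Rightarrow> real"
    and grad_h :: "'b \<Rightarrow> 'b"
    and grad_g :: "'a \<Rightarrow> 'a"
    and l l_g \<beta> \<delta> lam_bar mu_bar tau_bar c :: real
    and \<tau> lam \<mu> :: "nat \<Rightarrow> real"
    and gs x :: "nat \<Rightarrow> 'a"
    and G :: "'a \<times> 'a \<Rightarrow> ereal"
  defines "F \<equiv> objective f h A g"
  defines "c \<equiv> 1 / 2 * (l * (onorm A)\<^sup>2 * lam_bar + mu_bar)"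
  defines "G \<equiv> (\<lambda>(y, z). F y + indicat_inf C y + ereal (c * (norm (y - z))\<^sup>2))"
  assumes C: "C \<noteq> {}" "closed C"
    and A: "linear A"
    and f: "eproper f" "lsc f"
    and h: "\<And>y. GDERIV h y :> grad_h y" "l-lipschitz_on UNIV grad_h"
    and g: "\<And>y. g y \<noteq> -\<infinity>"
    and D: "open D" "convex D" "C \<subseteq> D"
    and g_on_D: "\<And>y. y \<in> D \<Longrightarrow> g y < \<infinity>" "continuous_on D g" "weakly_convex_modulus_on D g \<beta>"
    and params: "0 \<le> lam_bar" "0 \<le> mu_bar" "0 < \<delta>"
    and alg: "prox_subgrad_extrap C A f grad_h l g \<beta> lam_bar mu_bar \<delta> \<tau> lam \<mu> gs x"
    and bounded_below: "\<exists>m::real. \<forall>y\<in>C. ereal m \<le> F y"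
    and bounded_C0: "bounded {y \<in> C. F y \<le> F (x 0)}"
    and U: "open U" "C \<inter> edom f \<subseteq> U"
    and g_on_U: "\<And>y. y \<in> U \<Longrightarrow> g y < \<infinity>"
      "\<And>y. y \<in> U \<Longrightarrow> GDERIV (\<lambda>w. real_of_ereal (g w)) y :> grad_g y"
      "l_g-lipschitz_on (C \<inter> edom f) grad_g"
    and tau_liminf: "liminf (\<lambda>n. ereal (\<tau> n)) = ereal tau_bar" "0 < tau_bar"
    and KL: "\<And>y. y \<in> C \<inter> edom f \<Longrightarrow> KL_property G (y, y)"
  shows "\<exists>xs.
    (x \<longlonglongrightarrow> xs \<and> stationary_point C f h A g xs \<and> summable (\<lambda>n. norm (x (Suc n) - x n))) \<and>
    (\<forall>\<theta>. 0 \<le> \<theta> \<and> \<theta> < 1 \<and> (\<forall>y \<in> C \<inter> edom f. KL_property_exponent G (y, y) \<theta>) \<longrightarrow>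
      (\<theta> = 0 \<longrightarrow> (\<exists>N. \<forall>n\<ge>N. x n = xs)) \<and>
      (0 < \<theta> \<and> \<theta> \<le> 1 / 2 \<longrightarrow>
        (\<exists>\<gamma> \<rho>. 0 < \<gamma> \<and> 0 < \<rho> \<and> \<rho> < 1 \<and>
          (\<forall>n. norm (x n - xs) \<le> \<gamma> * \<rho> powr (real n / 2) \<and>
               (F (x 0) < \<infinity> \<or> n \<ge> 1 \<longrightarrow> \<bar>F (x n) - F xs\<bar> \<le> ereal (\<gamma> * \<rho> ^ n))))) \<and>
      (1 / 2 < \<theta> \<longrightarrow>
        (\<exists>\<gamma>. 0 < \<gamma> \<and>
          (\<forall>n\<ge>1. norm (x n - xs) \<le> \<gamma> * real n powr (- ((1 - \<theta>) / (2 * \<theta> - 1))) \<and>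
               \<bar>F (x n) - F xs\<bar> \<le> ereal (\<gamma> * real n powr (- ((2 - 2 * \<theta>) / (2 * \<theta> - 1))))))))"
proof -
  interpret P: prox_subgrad C D U A f g h grad_h grad_g l l_g \<beta> \<delta> lam_bar mu_bar tau_bar \<tau> lam \<mu> gs x
    by (rule prox_subgrad.intro; fact C(2) A f h g D g_on_D params alg U g_on_U tau_liminf
        bounded_below[unfolded F_def] bounded_C0[unfolded F_def])
  have G: "P.G = G"
    by (simp add: P.G_def P.c_def G_def F_def c_def)
  show ?thesis
    unfolding F_def by (rule P.convergence[unfolded G, OF KL])
qed

end
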